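(* Let $p_0,p_1,p_2,p_3\in[0,1]$, fix integers $r,s\ge1$, and put $\gamma:=r/(r+s)$. Put $p_m(\gamma):=\gamma\cdot\frac12+(1-\gamma)p_m$ for $m=0,1,2,3$. Assume that the spin system on $\mathbf{Z}$ whose flip rates are determined by $(p_0(\gamma),p_1(\gamma),p_2(\gamma),p_3(\gamma))$ is ergodic with unique stationary distribution $\pi^\gamma$. Then $$\lim_{N\to\infty}\mu_{[r,s]}^N=\mu_{(\gamma,1-\gamma)},$$ where $$\mu_{(\gamma,1-\gamma)}:=(1-\gamma)\sum_{w=0}^1\sum_{z=0}^1(\pi^\gamma)_{-1,1}(w,z)\,(p_{2w+z}-q_{2w+z}),$$ $q_m:=1-p_m$, and $(\pi^\gamma)_{-1,1}$ is the two-dimensional marginal of $\pi^\gamma$ at sites $-1$ and $1$. Here $\mu_{[r,s]}^N$ is the mean profit per turn to the ensemble of $N$ players repeatedly playing the nonrandom pattern $A^rB^s$ with probability parameters $p_0,p_1,p_2,p_3$.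
   Context: **Spin system.** Given $p_0,p_1,p_2,p_3\in[0,1]$ and $q_m:=1-p_m$, the spin system on $\mathbf{Z}$ determined by $(p_0,p_1,p_2,p_3)$ is the Feller process in $\{0,1\}^{\mathbf Z}$ whose generator is the closure of $$(\mathscr{L}f)(\mathbf x):=\sum_{i\in\mathbf Z}c_i(\mathbf x)[f(\mathbf x^i)-f(\mathbf x)]$$ for functions $f$ depending on only finitely many components. Here $\mathbf x^i$ is $\mathbf x$ with the $i$th component $x_i$ replaced by $1-x_i$, $m_i(\mathbf x):=2x_{i-1}+x_{i+1}$, and the flip rates are $c_i(\mathbf x):=p_{m_i(\mathbf x)}$ if $x_i=0$ and $c_i(\mathbf x):=q_{m_i(\mathbf x)}$ if $x_i=1$. In the claim, the same definition is used with each $p_m$ replaced by $p_m(\gamma)$ (and $q_m$ by $1-p_m(\gamma)$). The spin system is *ergodic* if it has a unique stationary distribution $\pi$ and the process at time $t$ converges in distribution to $\pi$ as $t\to\infty$, regardless of the initial distribution. **$N$-player games.** Let $N\ge3$ and $\Sigma:=\{0,1\}^N$. For $\mathbf x=(x_1,\ldots,x_N)\in\Sigma$, $x_i=1$ (resp. $0$) means player $i$ is a winner (resp. loser) of his most recent game; indices are circular: $x_0:=x_N$, $x_{N+1}:=x_1$. Let $m_i(\mathbf x):=2x_{i-1}+x_{i+1}\in\{0,1,2,3\}$, and let $\mathbf x^i$ be $\mathbf x$ with its $i$th component flipped. On $\Sigma^*:=\Sigma\times\{1,\ldots,N\}$, where the state $(\mathbf x,i)$ means that $\mathbf x$ is the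 status vector and $i$ is the next player to play, define the transition matrix $\mathbf P_B^*$ by, for all $(\mathbf x,i)\in\Sigma^*$ and $j\in\{1,\ldots,N\}$: $P_B^*((\mathbf x,i),(\mathbf x^i,j)):=N^{-1}p_{m_i(\mathbf x)}$ if $x_i=0$ and $N^{-1}q_{m_i(\mathbf x)}$ if $x_i=1$; $P_B^*((\mathbf x,i),(\mathbf x,j)):=N^{-1}q_{m_i(\mathbf x)}$ if $x_i=0$ and $N^{-1}p_{m_i(\mathbf x)}$ if $x_i=1$; all other entries are $0$. Let $\mathbf P_A^*$ be $\mathbf P_B^*$ with $p_0=p_1=p_2=p_3=1/2$. **Payoff and mean profit.** The payoff function $w$ equals $1$ for a win and $-1$ for a loss: $w((\mathbf x,i),(\mathbf x^i,j)):=1$ if $x_i=0$ and $-1$ if $x_i=1$; $w((\mathbf x,i),(\mathbf x,j)):=-1$ if $x_i=0$ and $1$ if $x_i=1$. Let $\{Y_n\}_{n\ge0}$ be a nonhomogeneous Markov chain in $\Sigma^*$ with arbitrary initial distribution and successive one-step transition matrices $\mathbf P_A^*$ ($r$ times), $\mathbf P_B^*$ ($s$ times), $\mathbf P_A^*$ ($r$ times), $\mathbf P_B^*$ ($s$ times), and so on. With $S_n:=\sum_{k=1}^n w(Y_{k-1},Y_k)$, the mean profit per turn $\mu_{[r,s]}^N$ is the (nonrandom) almost sure limit of $n^{-1}S_n$ as $n\to\infty$; this limit exists and does not depend on the initial distribution. *)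

theory Defs
  imports "HOL-Probability.Probability"
begin

text \<open>A status \<open>1\<close> or \<open>0\<close> is encoded as \<open>True\<close> or \<open>False\<close>. The parameters
  \<open>p\<^sub>0, \<dots>, p\<^sub>3\<close> are given as a function on \<open>nat\<close>; only its values at \<open>0, \<dots>, 3\<close> matter.\<close>

definition nbr_index :: "bool \<Rightarrow> bool \<Rightarrow> nat" where
  "nbr_index l r = 2 * of_bool l + of_bool r"

definition mix :: "real \<Rightarrow> (nat \<Rightarrow> real) \<Rightarrow> nat \<Rightarrow> real" where
  "mix \<gamma> p m = \<gamma> * (1/2) + (1 - \<gamma>) * p m"


section \<open>Feller processes\<close>

text \<open>A Feller process is represented by its transition function: \<open>K t x\<close> is the law at time
  \<open>t \<ge> 0\<close> of the process started at \<open>x\<close>, and \<open>\<nu> \<bind> K t\<close> its law at time \<open>t\<close> under the initial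
  distribution \<open>\<nu>\<close>. Values of \<open>K\<close> at negative times are irrelevant. The state spaces below are
  compact, so that \<open>'a \<Rightarrow>\<^sub>C real\<close>, with the supremum norm, is the space of all continuous functions.\<close>

definition transition_op ::
    "(real \<Rightarrow> 'a::topological_space \<Rightarrow> 'a measure) \<Rightarrow> real \<Rightarrow> ('a \<Rightarrow>\<^sub>C real) \<Rightarrow> ('a \<Rightarrow>\<^sub>C real)" where
  "transition_op K t f = Bcontfun (\<lambda>x. \<integral>y. f y \<partial>K t x)"

definition feller_process :: "(real \<Rightarrow> 'a::topological_space \<Rightarrow> 'a measure) \<Rightarrow> bool" where
  "feller_process K \<longleftrightarrow>
     (\<forall>t\<ge>0. K t \<in> borel \<rightarrow>\<^sub>M prob_algebra borel) \<and>
     (\<forall>x. K 0 x = return borel x) \<and>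
     (\<forall>s\<ge>0. \<forall>t\<ge>0. \<forall>x. K (s + t) x = K s x \<bind> K t) \<and>
     (\<forall>t\<ge>0. \<forall>f::'a \<Rightarrow>\<^sub>C real. continuous_on UNIV (\<lambda>x. \<integral>y. f y \<partial>K t x)) \<and>
     (\<forall>f::'a \<Rightarrow>\<^sub>C real. ((\<lambda>t. transition_op K t f) \<longlongrightarrow> f) (at_right 0))"

text \<open>Generators are represented by their graphs.\<close>

definition generator ::
    "(real \<Rightarrow> 'a::topological_space \<Rightarrow> 'a measure) \<Rightarrow> (('a \<Rightarrow>\<^sub>C real) \<times> ('a \<Rightarrow>\<^sub>C real)) set" where
  "generator K = {(f, g). ((\<lambda>t. (transition_op K t f - f) /\<^sub>R t) \<longlongrightarrow> g) (at_right 0)}"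

definition stationary_distribution ::
    "(real \<Rightarrow> 'a::topological_space \<Rightarrow> 'a measure) \<Rightarrow> 'a measure \<Rightarrow> bool" where
  "stationary_distribution K \<pi> \<longleftrightarrow>
     \<pi> \<in> space (prob_algebra borel) \<and> (\<forall>t\<ge>0. \<pi> \<bind> K t = \<pi>)"

definition ergodic_with ::
    "(real \<Rightarrow> 'a::topological_space \<Rightarrow> 'a measure) \<Rightarrow> 'a measure \<Rightarrow> bool" where
  "ergodic_with K \<pi> \<longleftrightarrow>
     stationary_distribution K \<pi> \<and>
     (\<forall>\<pi>'. stationary_distribution K \<pi>' \<longrightarrow> \<pi>' = \<pi>) \<and>
     (\<forall>\<nu>\<in>space (prob_algebra borel). \<forall>f::'a \<Rightarrow>\<^sub>C real.
        ((\<lambda>t. \<integral>x. f x \<partial>(\<nu> \<bind> K t)) \<longlongrightarrow> (\<integral>x. f x \<partial>\<pi>)) at_top)"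


section \<open>Spin systems on the integers\<close>

text \<open>With this instance the Borel sets of \<open>int \<Rightarrow> bool\<close>, for the product of the discrete topologies,
  are those of the product \<open>\<sigma>\<close>-algebra.\<close>

instance bool :: second_countable_topology
proof
  have "open = generate_topology (UNIV :: bool set set)"
  proof
    show "open A = generate_topology UNIV A" for A :: "bool set"
      by (simp only: discrete_topology_class.open_discrete generate_topology.Basis UNIV_I)
  qed
  then show "\<exists>B::bool set set. countable B \<and> open = generate_topology B"
    by (intro exI[of _ UNIV] conjI countable_finite) auto
qed

definition flip :: "'i \<Rightarrow> ('i \<Rightarrow> bool) \<Rightarrow> ('i \<Rightarrow> bool)" where
  "flip i x = x(i := \<not> x i)"

definition flip_rate :: "(nat \<Rightarrow> real) \<Rightarrow> int \<Rightarrow> (int \<Rightarrow> bool) \<Rightarrow> real" where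
  "flip_rate p i x =
     (let m = nbr_index (x (i - 1)) (x (i + 1)) in if x i then 1 - p m else p m)"

definition finitely_determined :: "(('i \<Rightarrow> 'b) \<Rightarrow> 'c) \<Rightarrow> bool" where
  "finitely_determined f \<longleftrightarrow> (\<exists>A. finite A \<and> (\<forall>x y. (\<forall>i\<in>A. x i = y i) \<longrightarrow> f x = f y))"

text \<open>For a finitely determined \<open>f\<close> only finitely many terms of the sum over the sites are nonzero.\<close>

definition spin_pregenerator ::
    "(nat \<Rightarrow> real) \<Rightarrow> (((int \<Rightarrow> bool) \<Rightarrow>\<^sub>C real) \<times> ((int \<Rightarrow> bool) \<Rightarrow>\<^sub>C real)) set" where
  "spin_pregenerator p =
     {(f, g). finitely_determined (apply_bcontfun f) \<and>
        (\<forall>x. apply_bcontfun g x = (\<Sum>\<^sub>\<infinity>i\<in>UNIV. flip_rate p i x * (f (flip i x) - f x)))}"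

definition spin_system ::
    "(nat \<Rightarrow> real) \<Rightarrow> (real \<Rightarrow> (int \<Rightarrow> bool) \<Rightarrow> (int \<Rightarrow> bool) measure) \<Rightarrow> bool" where
  "spin_system p K \<longleftrightarrow> feller_process K \<and> generator K = closure (spin_pregenerator p)"

definition marginal2 :: "(int \<Rightarrow> bool) measure \<Rightarrow> int \<Rightarrow> int \<Rightarrow> (bool \<times> bool) measure" where
  "marginal2 \<pi> i j = distr \<pi> (count_space UNIV) (\<lambda>x. (x i, x j))"


section \<open>Games with \<open>N\<close> players on a circle\<close>

text \<open>Status vectors are the extensional functions on \<open>{1..N}\<close>, so that equality of states is
  equality of their \<open>N\<close> components.\<close>

type_synonym game_state = "(nat \<Rightarrow> bool) \<times> nat"

definition game_states :: "nat \<Rightarrow> game_state set" where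
  "game_states N = ({1..N} \<rightarrow>\<^sub>E UNIV) \<times> {1..N}"

definition circ_index :: "nat \<Rightarrow> (nat \<Rightarrow> bool) \<Rightarrow> nat \<Rightarrow> nat" where
  "circ_index N x i =
     nbr_index (x (if i = 1 then N else i - 1)) (x (if i = N then 1 else i + 1))"

definition game_matrix :: "nat \<Rightarrow> (nat \<Rightarrow> real) \<Rightarrow> game_state \<Rightarrow> game_state \<Rightarrow> real" where
  "game_matrix N p = (\<lambda>(x, i) (y, j).
     let m = circ_index N x i in
       if y = flip i x then (if x i then 1 - p m else p m) / real N
       else if y = x then (if x i then p m else 1 - p m) / real N
       else 0)"

definition payoff :: "game_state \<Rightarrow> game_state \<Rightarrow> real" where
  "payoff = (\<lambda>(x, i) (y, j).
     if y = flip i x then (if x i then -1 else 1)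
     else if y = x then (if x i then 1 else -1)
     else 0)"

text \<open>\<open>P n\<close> is the one-step transition matrix from time \<open>n\<close> to time \<open>n + 1\<close>.\<close>

definition markov_chain ::
    "'w measure \<Rightarrow> 's set \<Rightarrow> (nat \<Rightarrow> 's \<Rightarrow> 's \<Rightarrow> real) \<Rightarrow> (nat \<Rightarrow> 'w \<Rightarrow> 's) \<Rightarrow> bool" where
  "markov_chain M S P Y \<longleftrightarrow>
     prob_space M \<and>
     (\<forall>n. Y n \<in> M \<rightarrow>\<^sub>M count_space S) \<and>
     (\<forall>n y. (\<forall>k\<le>Suc n. y k \<in> S) \<longrightarrow>
        measure M {\<omega>\<in>space M. \<forall>k\<le>Suc n. Y k \<omega> = y k} =
        measure M {\<omega>\<in>space M. \<forall>k\<le>n. Y k \<omega> = y k} * P n (y n) (y (Suc n)))"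

definition pattern_matrix ::
    "nat \<Rightarrow> nat \<Rightarrow> nat \<Rightarrow> (nat \<Rightarrow> real) \<Rightarrow> nat \<Rightarrow> game_state \<Rightarrow> game_state \<Rightarrow> real" where
  "pattern_matrix N r s p n =
     (if n mod (r + s) < r then game_matrix N (\<lambda>_. 1/2) else game_matrix N p)"

text \<open>The almost sure limit depends only on the law of the chain, which can be realised on the
  path space; the sample points are therefore taken to be of type \<open>nat \<Rightarrow> game_state\<close>.\<close>

definition is_mean_profit :: "nat \<Rightarrow> nat \<Rightarrow> nat \<Rightarrow> (nat \<Rightarrow> real) \<Rightarrow> real \<Rightarrow> bool" where
  "is_mean_profit N r s p \<mu> \<longleftrightarrow>
     (\<forall>(M :: (nat \<Rightarrow> game_state) measure) Y.
        markov_chain M (game_states N) (pattern_matrix N r s p) Y \<longrightarrow>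
        (AE \<omega> in M. (\<lambda>n. (\<Sum>k=1..n. payoff (Y (k - 1) \<omega>) (Y k \<omega>)) / real n) \<longlonglongrightarrow> \<mu>))"

definition mean_profit :: "nat \<Rightarrow> nat \<Rightarrow> nat \<Rightarrow> (nat \<Rightarrow> real) \<Rightarrow> real" where
  "mean_profit N r s p = (THE \<mu>. is_mean_profit N r s p \<mu>)"

end

theory Submission
  imports Defs
begin

text \<open>One step of a game with probabilities \<open>p\<close> changes the stationary mean of a function of the status
  vector by \<open>1/N\<close> times the mean of its image under the generator of the spin system on the circle
  with parameters \<open>p\<close>. Over one period \<open>A\<^sup>rB\<^sup>s\<close> these changes add up to zero, and up to \<open>O(1/N)\<close>
  the means at the different phases of the period agree. Hence the stationary mean \<open>\<Lambda>\<^sub>N\<close>, averaged over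
  rotations and transported to \<open>int \<Rightarrow> bool\<close> by periodic extension, satisfies \<open>\<Lambda>\<^sub>N(L f) = O(1/N)\<close> for the
  generator \<open>L\<close> with the mixed parameters \<open>(r/2 + s p)/(r + s)\<close> and every finitely determined \<open>f\<close>. By
  compactness the \<open>\<Lambda>\<^sub>N\<close> have cluster points that are probability measures; they annihilate the range of
  \<open>L\<close>, hence that of its closure, so they are stationary and by ergodicity equal to \<open>\<pi>\<close>. For fixed \<open>N\<close>
  the mean profit is a stationary mean by a martingale argument based on the Poisson equation, which is
  solvable because the fair game A forces a Doeblin condition.\<close>

section \<open>Markov operators on a finite set\<close>

text \<open>The obstacle at fixed N is that \<open>p m\<close> may be 0 or 1, so that game B can be
  deterministic and need not mix. The Doeblin bound therefore follows, from each start, one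
  trajectory: the first turn of each period is the fair game A and is steered at will, while every
  other turn takes an outcome of probability at least 1/2. \<open>mean_profit\<close> is a definite
  description over all chains, so its value rests on the strong law and also on the existence of a
  chain on the path space. A turn touches one uniformly chosen player, so local functions move at
  rate 1/N while the period stays fixed; hence the order of the games disappears in the limit and
  only their proportions survive. Averaging over rotations turns the random player to move into an
  observer at the origin, with neighbours at -1 and 1, and makes rotation invariance of the
  stationary law a non-issue. Stationarity of the limits comes straight from the semigroup: it maps
  the graph of its generator into itself, so the mean of \<open>transition_op K t f\<close> has
  derivative zero in t.\<close>

definition markov_operator :: "'s set \<Rightarrow> (('s \<Rightarrow> real) \<Rightarrow> 's \<Rightarrow> real) \<Rightarrow> bool" where
  "markov_operator S T \<longleftrightarrow>
     (\<forall>f g. \<forall>x\<in>S. T (\<lambda>y. f y + g y) x = T f x + T g x) \<and>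
     (\<forall>c f. \<forall>x\<in>S. T (\<lambda>y. c * f y) x = c * T f x) \<and>
     (\<forall>f. (\<forall>y\<in>S. 0 \<le> f y) \<longrightarrow> (\<forall>x\<in>S. 0 \<le> T f x)) \<and>
     (\<forall>x\<in>S. T (\<lambda>_. 1) x = 1)"

context
  fixes S :: "'s set" and T :: "('s \<Rightarrow> real) \<Rightarrow> 's \<Rightarrow> real"
  assumes T: "markov_operator S T"
begin

lemma markov_add: "x \<in> S \<Longrightarrow> T (\<lambda>y. f y + g y) x = T f x + T g x"
  and markov_scale: "x \<in> S \<Longrightarrow> T (\<lambda>y. c * f y) x = c * T f x"
  and markov_nonneg: "(\<And>y. y \<in> S \<Longrightarrow> 0 \<le> f y) \<Longrightarrow> x \<in> S \<Longrightarrow> 0 \<le> T f x"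
  and markov_one: "x \<in> S \<Longrightarrow> T (\<lambda>_. 1) x = 1"
  using T by (auto simp: markov_operator_def)

lemma markov_diff: "x \<in> S \<Longrightarrow> T (\<lambda>y. f y - g y) x = T f x - T g x"
  using markov_add[of x f "\<lambda>y. - 1 * g y"] markov_scale[of x "- 1" g] by simp

lemma markov_const: "x \<in> S \<Longrightarrow> T (\<lambda>_. c) x = c"
  using markov_scale[of x c "\<lambda>_. 1"] markov_one by simp

lemma markov_sum: "x \<in> S \<Longrightarrow> T (\<lambda>y. \<Sum>a\<in>A. f a y) x = (\<Sum>a\<in>A. T (f a) x)"
  by (induction A rule: infinite_finite_induct) (auto simp: markov_const markov_add)

lemma markov_mono:
  assumes "\<And>y. y \<in> S \<Longrightarrow> f y \<le> g y" "x \<in> S"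
  shows "T f x \<le> T g x"
  using markov_nonneg[of "\<lambda>y. g y - f y" x] assms by (simp add: markov_diff)

text \<open>\<open>T\<close> takes functions on the whole type but sees only their values on
  \<open>S\<close>; this licenses rewriting under \<open>T\<close> with facts that hold only on
  \<open>S\<close>.\<close>

lemma markov_cong:
  assumes "\<And>y. y \<in> S \<Longrightarrow> f y = g y" "x \<in> S"
  shows "T f x = T g x"
  using assms by (intro antisym markov_mono) auto

text \<open>Recovers a matrix from the abstract operator; being a finite sum, it lets
  \<open>T\<close> pass under the infinite series that solves the Poisson equation.\<close>

lemma markov_matrix:
  assumes "finite S" "x \<in> S"
  shows "T f x = (\<Sum>y\<in>S. f y * T (\<lambda>z. of_bool (z = y)) x)"
proof -
  have "T f x = T (\<lambda>z. \<Sum>y\<in>S. f y * of_bool (z = y)) x"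
    by (rule markov_cong) (use assms in auto)
  then show ?thesis
    using assms(2) by (simp add: markov_sum markov_scale)
qed

end

lemma markov_operator_id: "markov_operator S (\<lambda>f. f)"
  by (auto simp: markov_operator_def)

lemma markov_operator_comp:
  assumes T: "markov_operator S T" and U: "markov_operator S U"
  shows "markov_operator S (\<lambda>f. T (U f))"
  unfolding markov_operator_def
proof (intro conjI allI ballI impI)
  fix f g c x assume x: "x \<in> S"
  show "T (U (\<lambda>y. f y + g y)) x = T (U f) x + T (U g) x"
    using markov_cong[OF T markov_add[OF U] x] markov_add[OF T x] by simp
  show "T (U (\<lambda>y. c * f y)) x = c * T (U f) x"
    using markov_cong[OF T markov_scale[OF U] x] markov_scale[OF T x] by simp
  show "T (U (\<lambda>_. 1)) x = 1"
    using markov_cong[OF T markov_one[OF U] x] markov_one[OF T x] by simp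
  show "0 \<le> T (U f) x" if "\<forall>y\<in>S. 0 \<le> f y"
    using that x by (intro markov_nonneg[OF T] markov_nonneg[OF U]) auto
qed

lemma markov_operator_funpow: "markov_operator S T \<Longrightarrow> markov_operator S (T ^^ n)"
proof (induction n)
  case 0
  show ?case
    using markov_operator_id by (simp add: id_def)
next
  case (Suc n)
  then show ?case
    using markov_operator_comp[of S T "T ^^ n"] by (simp add: comp_def)
qed

text \<open>Doeblin's contraction: every row of \<open>T\<close> puts mass at least \<epsilon> on
  the common state \<open>y\<close>. Testing \<open>minor\<close> on the distances to the current
  minimum and maximum shows that both are pulled towards the value at \<open>y\<close>.\<close>

lemma minorized_powers_converge:
  assumes S: "finite S" and T: "markov_operator S T" and y: "y \<in> S" and "\<epsilon> > 0"
    and minor: "\<And>g x. (\<And>z. z \<in> S \<Longrightarrow> 0 \<le> g z) \<Longrightarrow> x \<in> S \<Longrightarrow> \<epsilon> * g y \<le> T g x"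
  obtains c B where "\<And>n x. x \<in> S \<Longrightarrow> \<bar>(T ^^ n) f x - c\<bar> \<le> B * (1 - \<epsilon>) ^ n"
proof -
  have "\<epsilon> \<le> 1"
    using minor[of "\<lambda>_. 1" y] y by (simp add: markov_one[OF T])
  define u where "u n = (T ^^ n) f" for n
  have u_Suc: "u (Suc n) = T (u n)" for n by (simp add: u_def)
  define a where "a n = Min (u n ` S)" for n
  define b where "b n = Max (u n ` S)" for n
  have le: "a n \<le> u n x" "u n x \<le> b n" if "x \<in> S" for n x
    using that S by (auto simp: a_def b_def)
  have lower: "a n + \<epsilon> * (u n y - a n) \<le> u (Suc n) x" if "x \<in> S" for n x
    using minor[of "\<lambda>z. u n z - a n" x] that le
    by (simp add: u_Suc markov_diff[OF T] markov_const[OF T])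
  have upper: "u (Suc n) x \<le> b n - \<epsilon> * (b n - u n y)" if "x \<in> S" for n x
    using minor[of "\<lambda>z. b n - u n z" x] that le
    by (simp add: u_Suc markov_diff[OF T] markov_const[OF T])
  have a_Suc: "a n + \<epsilon> * (u n y - a n) \<le> a (Suc n)" for n
    unfolding a_def[of "Suc n"] using S y lower by (intro Min.boundedI) auto
  have b_Suc: "b (Suc n) \<le> b n - \<epsilon> * (b n - u n y)" for n
    unfolding b_def[of "Suc n"] using S y upper by (intro Max.boundedI) auto
  have "incseq a"
  proof (rule incseq_SucI)
    fix n
    have "0 \<le> \<epsilon> * (u n y - a n)"
      using le(1)[OF y, of n] \<open>\<epsilon> > 0\<close> by simp
    then show "a n \<le> a (Suc n)"
      using a_Suc[of n] by linarith
  qed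
  have "decseq b"
  proof (rule decseq_SucI)
    fix n
    have "0 \<le> \<epsilon> * (b n - u n y)"
      using le(2)[OF y, of n] \<open>\<epsilon> > 0\<close> by simp
    then show "b (Suc n) \<le> b n"
      using b_Suc[of n] by linarith
  qed
  have ab: "a n \<le> b n" for n
    using le[OF y, of n] by linarith
  have ab': "a m \<le> b n" for m n
    using decseqD[OF \<open>decseq b\<close>, of n m] incseqD[OF \<open>incseq a\<close>, of m n] ab[of n] ab[of m]
    by (cases "m \<le> n") auto
  obtain c where "a \<longlonglongrightarrow> c" and a_le: "\<And>n. a n \<le> c"
    using incseq_convergent[OF \<open>incseq a\<close>, of "b 0"] ab' by blast
  have b_ge: "c \<le> b n" for n
    using \<open>a \<longlonglongrightarrow> c\<close> ab' by (intro LIMSEQ_le_const2) auto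
  have diff: "b n - a n \<le> (b 0 - a 0) * (1 - \<epsilon>) ^ n" for n
  proof (induction n)
    case (Suc n)
    \<comment> \<open>The value \<open>u n y\<close> cancels when the two one-step bounds are
      subtracted.\<close>
    have "b (Suc n) - a (Suc n) \<le> (1 - \<epsilon>) * (b n - a n)"
      using a_Suc[of n] b_Suc[of n] by (simp add: algebra_simps)
    also have "\<dots> \<le> (1 - \<epsilon>) * ((b 0 - a 0) * (1 - \<epsilon>) ^ n)"
      using Suc \<open>\<epsilon> \<le> 1\<close> by (intro mult_left_mono) auto
    finally show ?case by (simp add: algebra_simps)
  qed simp
  have "\<bar>(T ^^ n) f x - c\<bar> \<le> (b 0 - a 0) * (1 - \<epsilon>) ^ n" if "x \<in> S" for n x
    using le[OF that, of n] a_le[of n] b_ge[of n] diff[of n] by (auto simp: u_def)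
  then show thesis by (rule that)
qed

text \<open>The solution is the Neumann series of the centred powers \<open>T ^^ n\<close>: applying
  \<open>T\<close> shifts the index by one, so \<open>h - T h\<close> leaves only the term of index
  0.\<close>

lemma poisson_equation_minorized:
  assumes S: "finite S" and T: "markov_operator S T" and y: "y \<in> S" and "\<epsilon> > 0"
    and minor: "\<And>g x. (\<And>z. z \<in> S \<Longrightarrow> 0 \<le> g z) \<Longrightarrow> x \<in> S \<Longrightarrow> \<epsilon> * g y \<le> T g x"
  shows "\<exists>c h. \<forall>x\<in>S. f x - c = h x - T h x"
proof -
  obtain c B where cB: "\<And>n x. x \<in> S \<Longrightarrow> \<bar>(T ^^ n) f x - c\<bar> \<le> B * (1 - \<epsilon>) ^ n"
    using minorized_powers_converge[OF assms] by blast
  have "\<epsilon> \<le> 1"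
    using minor[of "\<lambda>_. 1" y] y by (simp add: markov_one[OF T])
  define v where "v n x = (T ^^ n) f x - c" for n x
  have v_Suc: "T (v n) x = v (Suc n) x" if "x \<in> S" for n x
    using that by (simp add: v_def[abs_def] markov_diff[OF T] markov_const[OF T])
  have summable: "summable (\<lambda>n. v n x)" if "x \<in> S" for x
  proof (rule summable_comparison_test'[of "\<lambda>n. B * (1 - \<epsilon>) ^ n" 0])
    show "summable (\<lambda>n. B * (1 - \<epsilon>) ^ n)"
      using \<open>\<epsilon> > 0\<close> \<open>\<epsilon> \<le> 1\<close> by (intro summable_mult summable_geometric) auto
  qed (use cB that in \<open>auto simp: v_def\<close>)
  define h where "h x = (\<Sum>n. v n x)" for x
  have "f x - c = h x - T h x" if x: "x \<in> S" for x
  proof -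
    have "(\<lambda>n. \<Sum>z\<in>S. v n z * T (\<lambda>w. of_bool (w = z)) x)
        sums (\<Sum>z\<in>S. h z * T (\<lambda>w. of_bool (w = z)) x)"
      unfolding h_def using summable by (intro sums_sum sums_mult2 summable_sums)
    then have "(\<lambda>n. v (Suc n) x) sums T h x"
      using x by (simp add: markov_matrix[OF T S, symmetric] v_Suc)
    then have "T h x = (\<Sum>n. v (Suc n) x)"
      by (simp add: sums_iff)
    then show ?thesis
      using suminf_split_head[OF summable[OF x]] by (simp add: h_def v_def)
  qed
  then show ?thesis by blast
qed

text \<open>If \<open>h\<close> solves the equation for \<open>Q\<^sup>m\<close>, then \<open>h + Q h + \<dots> + Q\<^sup>m\<^sup>-\<^sup>1 h\<close> solves it for \<open>Q\<close>.\<close>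

lemma poisson_equation:
  assumes S: "finite S" and Q: "markov_operator S Q" and y: "y \<in> S" and "\<epsilon> > 0"
    and minor: "\<And>g x. (\<And>z. z \<in> S \<Longrightarrow> 0 \<le> g z) \<Longrightarrow> x \<in> S \<Longrightarrow> \<epsilon> * g y \<le> (Q ^^ m) g x"
  shows "\<exists>c h. \<forall>x\<in>S. f x - c = h x - Q h x"
proof -
  obtain c h where ch: "\<forall>x\<in>S. f x - c = h x - (Q ^^ m) h x"
    using poisson_equation_minorized[OF S markov_operator_funpow[OF Q] y \<open>\<epsilon> > 0\<close> minor] by blast
  define h' where "h' x = (\<Sum>j<m. (Q ^^ j) h x)" for x
  have "h' x - Q h' x = h x - (Q ^^ m) h x" if "x \<in> S" for x
    using that sum_lessThan_telescope'[of "\<lambda>j. (Q ^^ j) h x" m]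
    by (simp add: h'_def[abs_def] markov_sum[OF Q] sum_subtractf)
  then have "\<forall>x\<in>S. f x - c = h' x - Q h' x"
    using ch by simp
  then show ?thesis by blast
qed

text \<open>The constant \<open>c\<close> in the Poisson equation is the stationary mean of \<open>f\<close>; this description
  makes invariance under \<open>Q\<close> immediate and avoids constructing a stationary distribution.\<close>

definition stationary_mean :: "'s set \<Rightarrow> (('s \<Rightarrow> real) \<Rightarrow> 's \<Rightarrow> real) \<Rightarrow> ('s \<Rightarrow> real) \<Rightarrow> real" where
  "stationary_mean S Q f = (THE c. \<exists>h. \<forall>x\<in>S. f x - c = h x - Q h x)"

context
  fixes S :: "'s set" and Q :: "('s \<Rightarrow> real) \<Rightarrow> 's \<Rightarrow> real"
  assumes S: "finite S" "S \<noteq> {}" and Q: "markov_operator S Q"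
    and poisson: "\<And>f. \<exists>c h. \<forall>x\<in>S. f x - c = h x - Q h x"
begin

text \<open>Minimum principle: at a minimizer of \<open>h\<close> the right-hand side is at most 0,
  so \<open>c\<close> is at least the value of \<open>f\<close> there.\<close>

lemma poisson_constant_ge:
  assumes eq: "\<forall>x\<in>S. f x - c = h x - Q h x" and "\<And>x. x \<in> S \<Longrightarrow> b \<le> f x"
  shows "b \<le> c"
proof -
  obtain x where x: "x \<in> S" "\<And>z. z \<in> S \<Longrightarrow> h x \<le> h z"
    using ex_is_arg_min_if_finite[OF S, of h] by (auto simp: is_arg_min_linorder)
  have "h x \<le> Q h x"
    using markov_mono[OF Q, of "\<lambda>_. h x" h x] x by (simp add: markov_const[OF Q])
  then show ?thesis
    using eq assms(2)[of x] x(1) by force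
qed

lemma stationary_mean_eqI:
  assumes "\<forall>x\<in>S. f x - c = h x - Q h x"
  shows "stationary_mean S Q f = c"
  unfolding stationary_mean_def
proof (rule the_equality)
  show "\<exists>h. \<forall>x\<in>S. f x - c = h x - Q h x" using assms by blast
next
  fix c' assume "\<exists>h. \<forall>x\<in>S. f x - c' = h x - Q h x"
  then obtain h' where h': "\<forall>x\<in>S. f x - c' = h' x - Q h' x" by blast
  have "c\<^sub>2 \<le> c\<^sub>1"
    if "\<forall>x\<in>S. f x - c\<^sub>1 = h\<^sub>1 x - Q h\<^sub>1 x" "\<forall>x\<in>S. f x - c\<^sub>2 = h\<^sub>2 x - Q h\<^sub>2 x" for c\<^sub>1 c\<^sub>2 h\<^sub>1 h\<^sub>2
  proof -
    \<comment> \<open>The difference of the two equations is a Poisson equation for the zero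
      function, and the minimum principle gives its constant a sign.\<close>
    have "\<forall>x\<in>S. 0 - (c\<^sub>1 - c\<^sub>2) = (h\<^sub>1 x - h\<^sub>2 x) - Q (\<lambda>y. h\<^sub>1 y - h\<^sub>2 y) x"
    proof
      fix x assume x: "x \<in> S"
      show "0 - (c\<^sub>1 - c\<^sub>2) = (h\<^sub>1 x - h\<^sub>2 x) - Q (\<lambda>y. h\<^sub>1 y - h\<^sub>2 y) x"
        using bspec[OF that(1) x] bspec[OF that(2) x] by (simp add: markov_diff[OF Q x])
    qed
    from poisson_constant_ge[OF this, of 0] show ?thesis by simp
  qed
  from this[OF assms h'] this[OF h' assms] show "c' = c" by simp
qed

lemma stationary_mean_poisson:
  obtains h where "\<And>x. x \<in> S \<Longrightarrow> f x - stationary_mean S Q f = h x - Q h x"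
  using poisson[of f] stationary_mean_eqI by blast

lemma stationary_mean_add:
  "stationary_mean S Q (\<lambda>x. f x + g x) = stationary_mean S Q f + stationary_mean S Q g"
proof -
  obtain h k where "\<And>x. x \<in> S \<Longrightarrow> f x - stationary_mean S Q f = h x - Q h x"
      "\<And>x. x \<in> S \<Longrightarrow> g x - stationary_mean S Q g = k x - Q k x"
    using stationary_mean_poisson by metis
  then show ?thesis
    by (intro stationary_mean_eqI[where h = "\<lambda>x. h x + k x"])
      (force simp: markov_add[OF Q] algebra_simps)
qed

lemma stationary_mean_scale: "stationary_mean S Q (\<lambda>x. a * f x) = a * stationary_mean S Q f"
proof -
  obtain h where "\<And>x. x \<in> S \<Longrightarrow> f x - stationary_mean S Q f = h x - Q h x"
    using stationary_mean_poisson by metis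
  then show ?thesis
    by (intro stationary_mean_eqI[where h = "\<lambda>x. a * h x"])
      (simp add: markov_scale[OF Q] flip: right_diff_distrib)
qed

lemma stationary_mean_ge: "(\<And>x. x \<in> S \<Longrightarrow> b \<le> f x) \<Longrightarrow> b \<le> stationary_mean S Q f"
  using stationary_mean_poisson[of f] poisson_constant_ge[of f] by metis

lemma stationary_mean_const: "stationary_mean S Q (\<lambda>_. a) = a"
  by (rule stationary_mean_eqI[where h = "\<lambda>_. 0"]) (auto simp: markov_const[OF Q])

text \<open>\<open>Q f\<close> and \<open>f\<close> differ by a coboundary, so the constant stays
  and the solution \<open>h\<close> changes to \<open>h - f\<close>.\<close>

lemma stationary_mean_invariant: "stationary_mean S Q (Q f) = stationary_mean S Q f"
proof -
  obtain h where "\<And>x. x \<in> S \<Longrightarrow> f x - stationary_mean S Q f = h x - Q h x"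
    using stationary_mean_poisson by metis
  then show ?thesis
    by (intro stationary_mean_eqI[where h = "\<lambda>x. h x - f x"])
      (force simp: markov_diff[OF Q] algebra_simps)
qed

end

section \<open>A strong law for finite inhomogeneous Markov chains\<close>

text \<open>Bounds exponential moments by a polynomial whose linear term has mean zero in a fair
  game. For \<open>x = - y < 0\<close> the claim amounts to
  \<open>1 \<le> (1 - y + y\<^sup>2) * exp y\<close>, and the quadratic Taylor bound on
  \<open>exp y\<close> is enough.\<close>

lemma exp_le_quadratic:
  fixes x :: real
  assumes "\<bar>x\<bar> \<le> 1"
  shows "exp x \<le> 1 + x + x\<^sup>2"
proof (cases "0 \<le> x")
  case True
  then show ?thesis using assms exp_bound by simp
next
  case False
  define y where "y = - x"
  have y: "0 \<le> y" "y \<le> 1" using False assms by (auto simp: y_def)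
  have "1 \<le> 1 + y\<^sup>2 / 2 + y ^ 3 / 2 + y ^ 4 / 2"
    using y by simp
  also have "\<dots> = (1 - y + y\<^sup>2) * (1 + y + y\<^sup>2 / 2)"
    by (simp add: field_simps power2_eq_square power3_eq_cube power4_eq_xxxx)
  also have "\<dots> \<le> (1 - y + y\<^sup>2) * exp y"
    using y by (intro mult_left_mono exp_lower_Taylor_quadratic) auto
  finally show ?thesis
    by (simp add: y_def exp_minus field_simps)
qed

locale finite_markov_chain =
  fixes M :: "'w measure" and S :: "'s set" and P :: "nat \<Rightarrow> 's \<Rightarrow> 's \<Rightarrow> real" and Y :: "nat \<Rightarrow> 'w \<Rightarrow> 's"
  assumes chain: "markov_chain M S P Y"
    and finite_S: "finite S"
    and P_nonneg: "x \<in> S \<Longrightarrow> y \<in> S \<Longrightarrow> 0 \<le> P n x y"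
    and P_sum: "x \<in> S \<Longrightarrow> (\<Sum>y\<in>S. P n x y) = 1"
begin

sublocale prob_space M
  using chain by (simp add: markov_chain_def)

lemma Y_measurable [measurable]: "Y n \<in> M \<rightarrow>\<^sub>M count_space S"
  using chain by (simp add: markov_chain_def)

lemma Y_in: "\<omega> \<in> space M \<Longrightarrow> Y n \<omega> \<in> S"
  using measurable_space[OF Y_measurable] by fastforce

definition cyl :: "nat \<Rightarrow> (nat \<Rightarrow> 's) \<Rightarrow> 'w set" where
  "cyl n y = {\<omega>\<in>space M. \<forall>k\<le>n. Y k \<omega> = y k}"

lemma cyl_sets [measurable]:
  assumes "\<And>k. k \<le> n \<Longrightarrow> y k \<in> S"
  shows "cyl n y \<in> sets M"
proof -
  have "{\<omega>\<in>space M. Y k \<omega> = y k} \<in> sets M" if "k \<le> n" for k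
    using measurable_sets[OF Y_measurable, of "{y k}" k] assms[OF that]
    by (simp add: vimage_def Int_def conj_commute)
  then have "(\<Inter>k\<in>{..n}. {\<omega>\<in>space M. Y k \<omega> = y k}) \<in> sets M"
    by (intro sets.finite_INT) auto
  also have "(\<Inter>k\<in>{..n}. {\<omega>\<in>space M. Y k \<omega> = y k}) = cyl n y"
    by (auto simp: cyl_def)
  finally show ?thesis .
qed

lemma prob_cyl_Suc:
  assumes "\<And>k. k \<le> n \<Longrightarrow> y k \<in> S" "z \<in> S"
  shows "prob (cyl (Suc n) (y(Suc n := z))) = prob (cyl n y) * P n (y n) z"
proof -
  have "cyl n (y(Suc n := z)) = cyl n y"
    by (auto simp: cyl_def)
  moreover have "prob (cyl (Suc n) (y(Suc n := z))) =
      prob (cyl n (y(Suc n := z))) * P n ((y(Suc n := z)) n) ((y(Suc n := z)) (Suc n))"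
    using chain assms unfolding markov_chain_def cyl_def
    by (elim conjE allE[of _ n] allE[of _ "y(Suc n := z)"]) auto
  ultimately show ?thesis by simp
qed

text \<open>Histories are extensional on \<open>{..n}\<close>, so there are finitely many and every
  expectation of a function of the history is a finite sum over cylinders; this takes the place of
  filtrations.\<close>

definition paths :: "nat \<Rightarrow> (nat \<Rightarrow> 's) set" where
  "paths n = {..n} \<rightarrow>\<^sub>E S"

lemma finite_paths: "finite (paths n)"
  unfolding paths_def using finite_S by (intro finite_PiE) auto

definition path :: "nat \<Rightarrow> 'w \<Rightarrow> nat \<Rightarrow> 's" where
  "path n \<omega> = (\<lambda>k\<in>{..n}. Y k \<omega>)"

lemma path_in: "\<omega> \<in> space M \<Longrightarrow> path n \<omega> \<in> paths n"
  using Y_in by (auto simp: path_def paths_def)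

lemma mem_cyl_iff: "y \<in> paths n \<Longrightarrow> \<omega> \<in> cyl n y \<longleftrightarrow> \<omega> \<in> space M \<and> y = path n \<omega>"
  by (auto simp: cyl_def path_def paths_def fun_eq_iff PiE_def extensional_def)

lemma paths_in: "y \<in> paths n \<Longrightarrow> k \<le> n \<Longrightarrow> y k \<in> S"
  by (auto simp: paths_def)

lemma
  fixes F :: "(nat \<Rightarrow> 's) \<Rightarrow> real"
  shows integrable_path: "integrable M (\<lambda>\<omega>. F (path n \<omega>))"
    and expectation_path: "expectation (\<lambda>\<omega>. F (path n \<omega>)) = (\<Sum>y\<in>paths n. F y * prob (cyl n y))"
proof -
  have eq: "F (path n \<omega>) = (\<Sum>y\<in>paths n. F y * indicator (cyl n y) \<omega>)" if "\<omega> \<in> space M" for \<omega>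
  proof -
    have "(\<Sum>y\<in>paths n. F y * indicator (cyl n y) \<omega>) = (\<Sum>y\<in>paths n. if y = path n \<omega> then F y else 0)"
      using that by (intro sum.cong) (auto simp: mem_cyl_iff indicator_def)
    then show ?thesis
      using path_in[OF that] finite_paths by simp
  qed
  have int: "integrable M (\<lambda>\<omega>. F y * indicator (cyl n y) \<omega>)" if "y \<in> paths n" for y
    using cyl_sets[of n y] paths_in[OF that]
    by (intro integrable_mult_right integrable_real_indicator) (auto simp: emeasure_eq_measure)
  show "integrable M (\<lambda>\<omega>. F (path n \<omega>))"
    using int by (simp add: eq cong: Bochner_Integration.integrable_cong)
  have "expectation (\<lambda>\<omega>. F (path n \<omega>)) = expectation (\<lambda>\<omega>. \<Sum>y\<in>paths n. F y * indicator (cyl n y) \<omega>)"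
    by (intro Bochner_Integration.integral_cong refl eq)
  also have "\<dots> = (\<Sum>y\<in>paths n. expectation (\<lambda>\<omega>. F y * indicator (cyl n y) \<omega>))"
    by (intro Bochner_Integration.integral_sum int)
  also have "\<dots> = (\<Sum>y\<in>paths n. F y * prob (cyl n y))"
    using cyl_sets[of n] paths_in by (intro sum.cong) (auto simp: Int_absorb2 cyl_def)
  finally show "expectation (\<lambda>\<omega>. F (path n \<omega>)) = (\<Sum>y\<in>paths n. F y * prob (cyl n y))" .
qed

text \<open>The Markov property in integrated form: conditioning on the history replaces the last
  transition by its mean under \<open>P n\<close>.\<close>

lemma expectation_step:
  fixes F :: "(nat \<Rightarrow> 's) \<Rightarrow> real" and v :: "'s \<Rightarrow> 's \<Rightarrow> real"
  shows "expectation (\<lambda>\<omega>. F (path n \<omega>) * v (Y n \<omega>) (Y (Suc n) \<omega>)) =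
      expectation (\<lambda>\<omega>. F (path n \<omega>) * (\<Sum>z\<in>S. P n (Y n \<omega>) z * v (Y n \<omega>) z))"
proof -
  have eq: "F (path n \<omega>) * v (Y n \<omega>) (Y (Suc n) \<omega>) =
      (\<Sum>y\<in>paths n. \<Sum>z\<in>S. F y * v (y n) z * indicator (cyl (Suc n) (y(Suc n := z))) \<omega>)"
    if \<omega>: "\<omega> \<in> space M" for \<omega>
  proof -
    have "(\<Sum>y\<in>paths n. \<Sum>z\<in>S. F y * v (y n) z * indicator (cyl (Suc n) (y(Suc n := z))) \<omega>) =
        (\<Sum>y\<in>paths n. \<Sum>z\<in>S. if z = Y (Suc n) \<omega> then if y = path n \<omega> then F y * v (y n) z else 0 else 0)"
    proof (intro sum.cong refl)
      fix y z assume "y \<in> paths n" "z \<in> S"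
      have "\<omega> \<in> cyl (Suc n) (y(Suc n := z)) \<longleftrightarrow> \<omega> \<in> cyl n y \<and> Y (Suc n) \<omega> = z"
        by (auto simp: cyl_def le_Suc_eq)
      also have "\<dots> \<longleftrightarrow> y = path n \<omega> \<and> Y (Suc n) \<omega> = z"
        using mem_cyl_iff[OF \<open>y \<in> paths n\<close>] \<omega> by auto
      finally show "F y * v (y n) z * indicator (cyl (Suc n) (y(Suc n := z))) \<omega> =
          (if z = Y (Suc n) \<omega> then if y = path n \<omega> then F y * v (y n) z else 0 else 0)"
        by (auto simp: indicator_def)
    qed
    then show ?thesis
      using path_in[OF \<omega>] finite_paths finite_S Y_in[OF \<omega>] by (simp add: path_def)
  qed
  have sets: "cyl (Suc n) (y(Suc n := z)) \<in> sets M" if "y \<in> paths n" "z \<in> S" for y z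
    using paths_in[OF that(1)] that(2) by (intro cyl_sets) auto
  then have int: "integrable M (\<lambda>\<omega>. F y * v (y n) z * indicator (cyl (Suc n) (y(Suc n := z))) \<omega>)"
    if "y \<in> paths n" "z \<in> S" for y z
    using that by (intro integrable_mult_right integrable_real_indicator) (auto simp: emeasure_eq_measure)
  have "expectation (\<lambda>\<omega>. F (path n \<omega>) * v (Y n \<omega>) (Y (Suc n) \<omega>)) = expectation (\<lambda>\<omega>.
      \<Sum>y\<in>paths n. \<Sum>z\<in>S. F y * v (y n) z * indicator (cyl (Suc n) (y(Suc n := z))) \<omega>)"
    by (intro Bochner_Integration.integral_cong refl eq)
  also have "\<dots> =
      (\<Sum>y\<in>paths n. expectation (\<lambda>\<omega>. \<Sum>z\<in>S. F y * v (y n) z * indicator (cyl (Suc n) (y(Suc n := z))) \<omega>))"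
    by (intro Bochner_Integration.integral_sum Bochner_Integration.integrable_sum int)
  also have "\<dots> = (\<Sum>y\<in>paths n. \<Sum>z\<in>S. F y * v (y n) z * prob (cyl (Suc n) (y(Suc n := z))))"
  proof (intro sum.cong refl)
    fix y assume y: "y \<in> paths n"
    have "expectation (\<lambda>\<omega>. \<Sum>z\<in>S. F y * v (y n) z * indicator (cyl (Suc n) (y(Suc n := z))) \<omega>) =
        (\<Sum>z\<in>S. expectation (\<lambda>\<omega>. F y * v (y n) z * indicator (cyl (Suc n) (y(Suc n := z))) \<omega>))"
      using int[OF y] by (intro Bochner_Integration.integral_sum)
    also have "\<dots> = (\<Sum>z\<in>S. F y * v (y n) z * prob (cyl (Suc n) (y(Suc n := z))))"
      using sets[OF y] by (intro sum.cong) (auto simp: Int_absorb2 cyl_def)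
    finally show "expectation (\<lambda>\<omega>. \<Sum>z\<in>S. F y * v (y n) z * indicator (cyl (Suc n) (y(Suc n := z))) \<omega>) =
        (\<Sum>z\<in>S. F y * v (y n) z * prob (cyl (Suc n) (y(Suc n := z))))" .
  qed
  also have "\<dots> = (\<Sum>y\<in>paths n. F y * (\<Sum>z\<in>S. P n (y n) z * v (y n) z) * prob (cyl n y))"
    using paths_in by (intro sum.cong refl) (simp add: prob_cyl_Suc sum_distrib_left sum_distrib_right mult_ac)
  also have "\<dots> = expectation (\<lambda>\<omega>. F (path n \<omega>) * (\<Sum>z\<in>S. P n (path n \<omega> n) z * v (path n \<omega> n) z))"
    using expectation_path[of "\<lambda>y. F y * (\<Sum>z\<in>S. P n (y n) z * v (y n) z)" n] by simp
  finally show "expectation (\<lambda>\<omega>. F (path n \<omega>) * v (Y n \<omega>) (Y (Suc n) \<omega>)) =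
      expectation (\<lambda>\<omega>. F (path n \<omega>) * (\<Sum>z\<in>S. P n (Y n \<omega>) z * v (Y n \<omega>) z))"
    by (simp add: path_def)
qed

context
  fixes u :: "nat \<Rightarrow> 's \<Rightarrow> 's \<Rightarrow> real" and C :: real
  assumes fair: "\<And>k x. x \<in> S \<Longrightarrow> (\<Sum>z\<in>S. P k x z * u k x z) = 0"
    and bounded: "\<And>k x z. x \<in> S \<Longrightarrow> z \<in> S \<Longrightarrow> \<bar>u k x z\<bar> \<le> C"
    and C: "1 \<le> C"
begin

text \<open>Fairness kills the linear term of \<open>exp_le_quadratic\<close>, so each step
  multiplies the exponential moment by at most \<open>1 + l\<^sup>2 * C\<^sup>2\<close>;
  \<open>l * C \<le> 1\<close> keeps the exponents in the range of that bound.\<close>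

lemma fair_game_exp_moment:
  assumes "0 \<le> l" "l * C \<le> 1"
  shows "integrable M (\<lambda>\<omega>. exp (l * (\<Sum>k<n. u k (Y k \<omega>) (Y (Suc k) \<omega>))))"
    and "expectation (\<lambda>\<omega>. exp (l * (\<Sum>k<n. u k (Y k \<omega>) (Y (Suc k) \<omega>)))) \<le> (1 + l\<^sup>2 * C\<^sup>2) ^ n"
proof -
  define F where "F n y = exp (l * (\<Sum>k<n. u k (y k) (y (Suc k))))" for n and y :: "nat \<Rightarrow> 's"
  have F_path: "F n (path n \<omega>) = exp (l * (\<Sum>k<n. u k (Y k \<omega>) (Y (Suc k) \<omega>)))" for n \<omega>
    by (simp add: F_def path_def)
  show "integrable M (\<lambda>\<omega>. exp (l * (\<Sum>k<n. u k (Y k \<omega>) (Y (Suc k) \<omega>))))"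
    using integrable_path[of "F n" n] by (simp add: F_path)
  have step: "(\<Sum>z\<in>S. P n x z * exp (l * u n x z)) \<le> 1 + l\<^sup>2 * C\<^sup>2" if x: "x \<in> S" for n x
  proof -
    have "(\<Sum>z\<in>S. P n x z * exp (l * u n x z)) \<le> (\<Sum>z\<in>S. P n x z * (1 + l * u n x z + l\<^sup>2 * C\<^sup>2))"
    proof (intro sum_mono mult_left_mono P_nonneg x)
      fix z assume z: "z \<in> S"
      have lu: "\<bar>l * u n x z\<bar> \<le> l * C"
        using bounded[OF x z] assms(1) by (simp add: abs_mult mult_left_mono)
      then have "(l * u n x z)\<^sup>2 \<le> (l * C)\<^sup>2"
        by (intro abs_le_square_iff[THEN iffD1]) auto
      then show "exp (l * u n x z) \<le> 1 + l * u n x z + l\<^sup>2 * C\<^sup>2"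
        using exp_le_quadratic[of "l * u n x z"] lu assms(2) by (simp add: power_mult_distrib)
    qed
    also have "\<dots> = (\<Sum>z\<in>S. P n x z) + l * (\<Sum>z\<in>S. P n x z * u n x z) + l\<^sup>2 * C\<^sup>2 * (\<Sum>z\<in>S. P n x z)"
      by (simp add: sum.distrib sum_distrib_left sum_distrib_right distrib_left mult_ac)
    finally show ?thesis
      using fair[OF x] P_sum[OF x] by simp
  qed
  show "expectation (\<lambda>\<omega>. exp (l * (\<Sum>k<n. u k (Y k \<omega>) (Y (Suc k) \<omega>)))) \<le> (1 + l\<^sup>2 * C\<^sup>2) ^ n"
  proof (induction n)
    case (Suc n)
    have "expectation (\<lambda>\<omega>. F (Suc n) (path (Suc n) \<omega>)) =
        expectation (\<lambda>\<omega>. F n (path n \<omega>) * exp (l * u n (Y n \<omega>) (Y (Suc n) \<omega>)))"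
      by (simp add: F_path distrib_left exp_add)
    also have "\<dots> = expectation (\<lambda>\<omega>. F n (path n \<omega>) * (\<Sum>z\<in>S. P n (Y n \<omega>) z * exp (l * u n (Y n \<omega>) z)))"
      using expectation_step[where F = "F n" and v = "\<lambda>x z. exp (l * u n x z)" and n = n] by simp
    also have "\<dots> \<le> expectation (\<lambda>\<omega>. F n (path n \<omega>) * (1 + l\<^sup>2 * C\<^sup>2))"
    proof (rule integral_mono)
      show "integrable M (\<lambda>\<omega>. F n (path n \<omega>) * (\<Sum>z\<in>S. P n (Y n \<omega>) z * exp (l * u n (Y n \<omega>) z)))"
        using integrable_path[of "\<lambda>y. F n y * (\<Sum>z\<in>S. P n (y n) z * exp (l * u n (y n) z))" n]
        by (simp add: path_def)
      show "integrable M (\<lambda>\<omega>. F n (path n \<omega>) * (1 + l\<^sup>2 * C\<^sup>2))"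
        using integrable_path[of "F n" n] by simp
    qed (use step Y_in in \<open>auto intro!: mult_left_mono simp: F_def\<close>)
    also have "\<dots> \<le> (1 + l\<^sup>2 * C\<^sup>2) ^ n * (1 + l\<^sup>2 * C\<^sup>2)"
      using Suc by (simp add: F_path mult_right_mono)
    finally show ?case by (simp add: F_path mult.commute)
  qed (simp add: prob_space)
qed

text \<open>Chernoff's bound makes the probability of exceeding \<open>e * n\<close> decay
  geometrically, and Borel-Cantelli concludes.\<close>

lemma fair_game_eventually_le:
  fixes e :: real
  assumes "0 < e" "e \<le> 1"
  shows "AE \<omega> in M. \<forall>\<^sub>F n in sequentially. (\<Sum>k<n. u k (Y k \<omega>) (Y (Suc k) \<omega>)) \<le> e * n"
proof -
  define W where "W n \<omega> = (\<Sum>k<n. u k (Y k \<omega>) (Y (Suc k) \<omega>))" for n \<omega>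
  \<comment> \<open>The minimizer of \<open>l\<^sup>2 * C\<^sup>2 - l * e\<close>, where this
    exponent equals \<open>- (l * e / 2)\<close>.\<close>
  define l where "l = e / (2 * C\<^sup>2)"
  have "0 < l" using assms C by (simp add: l_def)
  have "l * C \<le> 1"
    using assms C by (simp add: l_def power2_eq_square field_simps)
  define q where "q = (1 + l\<^sup>2 * C\<^sup>2) * exp (- (l * e))"
  have "0 \<le> q" by (simp add: q_def)
  have "q \<le> exp (l\<^sup>2 * C\<^sup>2) * exp (- (l * e))"
    unfolding q_def by (intro mult_right_mono exp_ge_add_one_self) auto
  also have "\<dots> = exp (- (l * e / 2))"
    using C by (simp add: l_def power2_eq_square flip: exp_add)
  also have "\<dots> < 1"
    using \<open>0 < l\<close> assms by simp
  finally have "q < 1" .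
  define A where "A n = {\<omega>\<in>space M. exp (l * e * n) \<le> exp (l * W n \<omega>)}" for n
  have int: "integrable M (\<lambda>\<omega>. exp (l * W n \<omega>))" for n
    unfolding W_def using \<open>0 < l\<close> \<open>l * C \<le> 1\<close> by (intro fair_game_exp_moment) auto
  then have [measurable]: "A n \<in> sets M" for n
    unfolding A_def by (intro borel_measurable_le[OF _ borel_measurable_integrable]) auto
  have prob_A: "prob (A n) \<le> q ^ n" for n
  proof -
    have "prob (A n) \<le> expectation (\<lambda>\<omega>. exp (l * W n \<omega>)) / exp (l * e * n)"
      unfolding A_def by (rule integral_Markov_inequality_measure[OF int]) auto
    also have "\<dots> \<le> (1 + l\<^sup>2 * C\<^sup>2) ^ n / exp (l * e * n)"
      unfolding W_def using \<open>0 < l\<close> \<open>l * C \<le> 1\<close>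
      by (intro divide_right_mono fair_game_exp_moment) auto
    also have "\<dots> = q ^ n"
      by (simp add: q_def power_mult_distrib exp_minus exp_of_nat2_mult divide_inverse power_inverse)
    finally show ?thesis .
  qed
  have "summable (\<lambda>n. prob (A n))"
    using prob_A \<open>0 \<le> q\<close> \<open>q < 1\<close>
    by (intro summable_comparison_test'[OF summable_geometric[of q]]) auto
  then have "AE \<omega> in M. \<forall>\<^sub>F n in sequentially. \<omega> \<in> space M - A n"
    by (intro borel_cantelli_AE1) (auto simp: emeasure_eq_measure)
  then show ?thesis
  proof (rule AE_mp, intro AE_I2 impI)
    fix \<omega> assume "\<forall>\<^sub>F n in sequentially. \<omega> \<in> space M - A n"
    then show "\<forall>\<^sub>F n in sequentially. (\<Sum>k<n. u k (Y k \<omega>) (Y (Suc k) \<omega>)) \<le> e * n"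
      by eventually_elim (use \<open>0 < l\<close> in \<open>auto simp: A_def W_def mult.assoc\<close>)
  qed
qed

end

lemma fair_game_slln:
  fixes u :: "nat \<Rightarrow> 's \<Rightarrow> 's \<Rightarrow> real"
  assumes fair: "\<And>k x. x \<in> S \<Longrightarrow> (\<Sum>z\<in>S. P k x z * u k x z) = 0"
    and bounded: "\<And>k x z. x \<in> S \<Longrightarrow> z \<in> S \<Longrightarrow> \<bar>u k x z\<bar> \<le> C"
  shows "AE \<omega> in M. (\<lambda>n. (\<Sum>k<n. u k (Y k \<omega>) (Y (Suc k) \<omega>)) / n) \<longlonglongrightarrow> 0"
proof -
  have bounded': "\<bar>u k x z\<bar> \<le> max 1 C" if "x \<in> S" "z \<in> S" for k x z
    using bounded[OF that, of k] by linarith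
  have "AE \<omega> in M. \<forall>m. (\<forall>\<^sub>F n in sequentially. (\<Sum>k<n. u k (Y k \<omega>) (Y (Suc k) \<omega>)) \<le> inverse (Suc m) * n) \<and>
      (\<forall>\<^sub>F n in sequentially. (\<Sum>k<n. - u k (Y k \<omega>) (Y (Suc k) \<omega>)) \<le> inverse (Suc m) * n)"
    unfolding AE_all_countable
  proof (intro allI AE_conjI)
    fix m :: nat
    have m: "0 < inverse (real (Suc m))" "inverse (real (Suc m)) \<le> 1"
      by (auto simp: field_simps)
    show "AE \<omega> in M. \<forall>\<^sub>F n in sequentially. (\<Sum>k<n. u k (Y k \<omega>) (Y (Suc k) \<omega>)) \<le> inverse (Suc m) * n"
      using fair bounded' by (intro fair_game_eventually_le[where C = "max 1 C"] m) auto
    show "AE \<omega> in M. \<forall>\<^sub>F n in sequentially. (\<Sum>k<n. - u k (Y k \<omega>) (Y (Suc k) \<omega>)) \<le> inverse (Suc m) * n"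
      using fair bounded'
      by (intro fair_game_eventually_le[where u = "\<lambda>k x z. - u k x z" and C = "max 1 C"] m)
        (auto simp: sum_negf)
  qed
  then show ?thesis
  proof (rule AE_mp, intro AE_I2 impI)
    fix \<omega>
    let ?W = "\<lambda>n. \<Sum>k<n. u k (Y k \<omega>) (Y (Suc k) \<omega>)"
    assume *: "\<forall>m. (\<forall>\<^sub>F n in sequentially. ?W n \<le> inverse (Suc m) * n) \<and>
      (\<forall>\<^sub>F n in sequentially. (\<Sum>k<n. - u k (Y k \<omega>) (Y (Suc k) \<omega>)) \<le> inverse (Suc m) * n)"
    show "(\<lambda>n. ?W n / n) \<longlonglongrightarrow> 0"
    proof (rule tendstoI)
      fix e :: real assume "0 < e"
      then obtain m where m: "inverse (real (Suc m)) < e"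
        using reals_Archimedean by blast
      from *[rule_format, of m, THEN conjunct1] *[rule_format, of m, THEN conjunct2]
        eventually_gt_at_top[of 0]
      show "\<forall>\<^sub>F n in sequentially. dist (?W n / n) 0 < e"
      proof eventually_elim
        case (elim n)
        then have "\<bar>?W n\<bar> \<le> inverse (Suc m) * n"
          by (auto simp: sum_negf abs_le_iff)
        then have "\<bar>?W n\<bar> / n \<le> inverse (Suc m)"
          using elim(3) by (simp add: field_simps)
        then show ?case
          using m by simp
      qed
    qed
  qed
qed

text \<open>The function \<open>H\<close> turns the partial sums into a martingale with bounded increments.\<close>

lemma additive_functional_slln:
  fixes w :: "'s \<Rightarrow> 's \<Rightarrow> real" and H :: "nat \<Rightarrow> 's \<Rightarrow> real" and \<mu> :: real
  assumes eq: "\<And>n x. x \<in> S \<Longrightarrow> H n x = (\<Sum>z\<in>S. P n x z * (w x z + H (Suc n) z))"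
    and bound: "\<And>n x. x \<in> S \<Longrightarrow> \<bar>H n x + n * \<mu>\<bar> \<le> B"
    and w: "\<And>x z. x \<in> S \<Longrightarrow> z \<in> S \<Longrightarrow> \<bar>w x z\<bar> \<le> W"
  shows "AE \<omega> in M. (\<lambda>n. (\<Sum>k=1..n. w (Y (k - 1) \<omega>) (Y k \<omega>)) / n) \<longlonglongrightarrow> \<mu>"
proof -
  define u where "u k x z = w x z + H (Suc k) z - H k x" for k x z
  have fair: "(\<Sum>z\<in>S. P k x z * u k x z) = 0" if "x \<in> S" for k x
  proof -
    have "(\<Sum>z\<in>S. P k x z * u k x z) = (\<Sum>z\<in>S. P k x z * (w x z + H (Suc k) z)) - (\<Sum>z\<in>S. P k x z) * H k x"
      by (simp add: u_def right_diff_distrib sum_subtractf sum_distrib_right)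
    then show ?thesis
      using eq[OF that] P_sum[OF that] by simp
  qed
  have bounded: "\<bar>u k x z\<bar> \<le> W + 2 * B + \<bar>\<mu>\<bar>" if "x \<in> S" "z \<in> S" for k x z
  proof -
    \<comment> \<open>\<open>H\<close> drifts by about \<open>- \<mu>\<close> per turn; adding
      \<open>k * \<mu>\<close> to it expresses the increment through bounded quantities.\<close>
    have "u k x z = w x z + (H (Suc k) z + Suc k * \<mu>) - (H k x + k * \<mu>) - \<mu>"
      by (simp add: u_def algebra_simps)
    then show ?thesis
      using w[OF that] bound[OF that(2), of "Suc k"] bound[OF that(1), of k] by linarith
  qed
  have "AE \<omega> in M. (\<lambda>n. (\<Sum>k<n. u k (Y k \<omega>) (Y (Suc k) \<omega>)) / n) \<longlonglongrightarrow> 0"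
    by (rule fair_game_slln[OF fair bounded])
  then show ?thesis
  proof (rule AE_mp, intro AE_I2 impI)
    fix \<omega> assume \<omega>: "\<omega> \<in> space M"
      and lim: "(\<lambda>n. (\<Sum>k<n. u k (Y k \<omega>) (Y (Suc k) \<omega>)) / n) \<longlonglongrightarrow> 0"
    have bnd: "(\<lambda>n. (H n (Y n \<omega>) + n * \<mu>) / n) \<longlonglongrightarrow> 0"
    proof (rule Lim_null_comparison)
      show "\<forall>\<^sub>F n in sequentially. norm ((H n (Y n \<omega>) + n * \<mu>) / n) \<le> B / n"
        using bound Y_in[OF \<omega>] by (auto simp: divide_right_mono)
      show "(\<lambda>n. B / real n) \<longlonglongrightarrow> 0"
        by (intro tendsto_divide_0[OF tendsto_const] filterlim_real_sequentially
            filterlim_at_top_imp_at_infinity)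
    qed
    have H0: "(\<lambda>n. H 0 (Y 0 \<omega>) / n) \<longlonglongrightarrow> 0"
      by (intro tendsto_divide_0[OF tendsto_const] filterlim_real_sequentially
            filterlim_at_top_imp_at_infinity)
    have "(\<Sum>k<n. u k (Y k \<omega>) (Y (Suc k) \<omega>)) =
        (\<Sum>k=1..n. w (Y (k - 1) \<omega>) (Y k \<omega>)) + H n (Y n \<omega>) - H 0 (Y 0 \<omega>)" for n
      by (induction n) (auto simp: u_def)
    then have "(\<Sum>k=1..n. w (Y (k - 1) \<omega>) (Y k \<omega>)) / n =
        (\<Sum>k<n. u k (Y k \<omega>) (Y (Suc k) \<omega>)) / n - (H n (Y n \<omega>) + n * \<mu>) / n + H 0 (Y 0 \<omega>) / n + \<mu>"
      if "n > 0" for n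
      using that by (simp add: field_simps)
    then have ev: "\<forall>\<^sub>F n in sequentially. (\<Sum>k<n. u k (Y k \<omega>) (Y (Suc k) \<omega>)) / n -
        (H n (Y n \<omega>) + n * \<mu>) / n + H 0 (Y 0 \<omega>) / n + \<mu> = (\<Sum>k=1..n. w (Y (k - 1) \<omega>) (Y k \<omega>)) / n"
      by (intro eventually_mono[OF eventually_gt_at_top[of 0]]) simp
    have "(\<lambda>n. (\<Sum>k<n. u k (Y k \<omega>) (Y (Suc k) \<omega>)) / n -
        (H n (Y n \<omega>) + n * \<mu>) / n + H 0 (Y 0 \<omega>) / n + \<mu>) \<longlonglongrightarrow> 0 - 0 + 0 + \<mu>"
      by (intro tendsto_intros lim bnd H0)
    then show "(\<lambda>n. (\<Sum>k=1..n. w (Y (k - 1) \<omega>) (Y k \<omega>)) / n) \<longlonglongrightarrow> \<mu>"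
      using filterlim_cong[OF refl refl ev] by simp
  qed
qed

end

section \<open>Existence of finite inhomogeneous Markov chains\<close>

text \<open>The chain is driven by independent variables indexed by time and current state, so that
  cylinder events become rectangles of the product measure.\<close>

lemma markov_chain_exists:
  fixes S :: "'s set" and P :: "nat \<Rightarrow> 's \<Rightarrow> 's \<Rightarrow> real"
  assumes S: "finite S" "x\<^sub>0 \<in> S"
    and P_nonneg: "\<And>n x y. x \<in> S \<Longrightarrow> y \<in> S \<Longrightarrow> 0 \<le> P n x y"
    and P_sum: "\<And>n x. x \<in> S \<Longrightarrow> (\<Sum>y\<in>S. P n x y) = 1"
  obtains M :: "(nat \<Rightarrow> 's) measure" and Y where "markov_chain M S P Y"
proof -
  define f where "f k z y = (if y \<in> S then P k z y else 0)" for k z y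
  define q where "q k z = (if z \<in> S then embed_pmf (f k z) else return_pmf x\<^sub>0)" for k z
  have pmf_q: "pmf (q k z) y = f k z y" if "z \<in> S" for k z y
  proof -
    have "(\<integral>\<^sup>+ y. ennreal (f k z y) \<partial>count_space UNIV) = (\<Sum>y\<in>S. ennreal (f k z y))"
      using S by (intro nn_integral_count_space') (auto simp: f_def)
    also have "\<dots> = ennreal (\<Sum>y\<in>S. f k z y)"
      using P_nonneg[OF that] by (intro sum_ennreal) (auto simp: f_def)
    also have "\<dots> = 1"
      using P_sum[OF that] by (simp add: f_def)
    finally have "pmf (embed_pmf (f k z)) y = f k z y"
      using P_nonneg[OF that] by (intro pmf_embed_pmf) (auto simp: f_def)
    then show ?thesis
      using that by (simp add: q_def)
  qed
  \<comment> \<open>The driving variables range over the whole type and lie in \<open>S\<close> only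
    almost surely; \<open>proj\<close> keeps the path in \<open>S\<close> at every sample point, as
    measurability into \<open>count_space S\<close> demands.\<close>
  define proj where "proj v = (if v \<in> S then v else x\<^sub>0)" for v
  have prob_q: "measure (measure_pmf (q k z)) {v. proj v = y} = P k z y" if "z \<in> S" "y \<in> S" for k z y
  proof -
    have "measure (measure_pmf (q k z)) {v. proj v = y} = measure (measure_pmf (q k z)) {y}"
    proof (rule measure_pmf.finite_measure_eq_AE)
      show "AE v in measure_pmf (q k z). v \<in> {v. proj v = y} \<longleftrightarrow> v \<in> {y}"
        using that by (intro AE_pmfI) (auto simp: set_pmf_eq pmf_q f_def proj_def split: if_splits)
    qed auto
    then show ?thesis
      using that by (simp add: measure_pmf_single pmf_q f_def)
  qed
  define Q where "Q i = measure_pmf (q (fst i) (snd i))" for i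
  interpret Q_prob: prob_space "Q i" for i
    unfolding Q_def by (rule measure_pmf.prob_space_axioms)
  interpret Q: product_prob_space Q UNIV
    by unfold_locales
  define N where "N = PiM UNIV Q"
  interpret N: prob_space N
    unfolding N_def by (rule Q.prob_space_axioms)
  define X where "X \<omega> = rec_nat x\<^sub>0 (\<lambda>n x. proj (\<omega> (n, x)))" for \<omega> :: "nat \<times> 's \<Rightarrow> 's"
  have X_0: "X \<omega> 0 = x\<^sub>0" and X_Suc: "X \<omega> (Suc n) = proj (\<omega> (n, X \<omega> n))" for \<omega> n
    by (simp_all add: X_def)
  have X_meas [measurable]: "(\<lambda>\<omega>. X \<omega> n) \<in> N \<rightarrow>\<^sub>M count_space S" for n
  proof (induction n)
    case 0
    show ?case using S by (simp add: X_0)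
  next
    case (Suc n)
    have "(\<lambda>\<omega>. proj (\<omega> (n, x))) \<in> N \<rightarrow>\<^sub>M count_space S" for x
    proof (rule measurable_compose[where f = "\<lambda>\<omega>. \<omega> (n, x)" and N = "Q (n, x)" and g = proj])
      show "(\<lambda>\<omega>. \<omega> (n, x)) \<in> N \<rightarrow>\<^sub>M Q (n, x)"
        unfolding N_def by (rule measurable_component_singleton) simp
      show "proj \<in> Q (n, x) \<rightarrow>\<^sub>M count_space S"
        using S by (auto simp: Q_def proj_def)
    qed
    then show ?case
      unfolding X_Suc
      by (rule measurable_compose_countable'[where f = "\<lambda>x \<omega>. proj (\<omega> (n, x))", OF _ Suc])
        (rule countable_finite[OF S(1)])
  qed
  have cyl: "measure N {\<omega>\<in>space N. \<forall>k\<le>n. X \<omega> k = y k} =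
      of_bool (y 0 = x\<^sub>0) * (\<Prod>k<n. P k (y k) (y (Suc k)))"
    if y: "\<And>k. k \<le> n \<Longrightarrow> y k \<in> S" for n y
  proof (cases "y 0 = x\<^sub>0")
    case False
    then have "{\<omega>\<in>space N. \<forall>k\<le>n. X \<omega> k = y k} = {}"
      using X_0 by (metis (mono_tags, lifting) Collect_empty_eq le0)
    then show ?thesis using False by (simp only: measure_empty) simp
  next
    case True
    \<comment> \<open>A path \<open>y\<close> reads exactly the coordinates \<open>(k, y k)\<close>;
      they are distinct because their times are, so their probabilities multiply.\<close>
    define J where "J = (\<lambda>k. (k, y k)) ` {..<n}"
    define A where "A i = {v. proj v = y (Suc (fst i))}" for i :: "nat \<times> 's"
    have eq: "(\<forall>k\<le>n. X \<omega> k = y k) \<longleftrightarrow> (\<forall>i\<in>J. \<omega> i \<in> A i)" for \<omega>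
      unfolding J_def
    proof (induction n)
      case 0
      show ?case using True by (simp add: X_0)
    next
      case (Suc n)
      have "(\<forall>k\<le>Suc n. X \<omega> k = y k) \<longleftrightarrow> (\<forall>k\<le>n. X \<omega> k = y k) \<and> proj (\<omega> (n, y n)) = y (Suc n)"
        by (metis X_Suc le_Suc_eq order_refl)
      then show ?case
        using Suc by (auto simp: A_def lessThan_Suc)
    qed
    have "emeasure N {\<omega>\<in>space N. \<forall>k\<le>n. X \<omega> k = y k} = (\<Prod>i\<in>J. emeasure (Q i) (A i))"
      unfolding N_def eq by (rule Q.emeasure_PiM_Collect) (auto simp: J_def Q_def)
    then have "measure N {\<omega>\<in>space N. \<forall>k\<le>n. X \<omega> k = y k} = (\<Prod>i\<in>J. measure (Q i) (A i))"
      by (simp add: Q_prob.emeasure_eq_measure prod_ennreal measure_eq_emeasure_eq_ennreal prod_nonneg)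
    also have "\<dots> = (\<Prod>k<n. measure (Q (k, y k)) (A (k, y k)))"
      unfolding J_def by (subst prod.reindex) (auto simp: inj_on_def)
    also have "\<dots> = (\<Prod>k<n. P k (y k) (y (Suc k)))"
      using y by (intro prod.cong) (auto simp: Q_def A_def prob_q)
    finally show ?thesis using True by simp
  qed
  \<comment> \<open>The law of the path is used because the sample points must be sequences of
    states.\<close>
  define M where "M = distr N (PiM UNIV (\<lambda>_. count_space S)) X"
  have X_meas' [measurable]: "X \<in> N \<rightarrow>\<^sub>M PiM UNIV (\<lambda>_. count_space S)"
    using measurable_space[OF X_meas] by (intro measurable_PiM_single' X_meas) auto
  have Y_meas [measurable]: "(\<lambda>\<xi>. \<xi> n) \<in> M \<rightarrow>\<^sub>M count_space S" for n
    unfolding M_def by simp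
  have M_cyl: "measure M {\<xi>\<in>space M. \<forall>k\<le>n. \<xi> k = y k} = measure N {\<omega>\<in>space N. \<forall>k\<le>n. X \<omega> k = y k}"
    if y: "\<And>k. k \<le> n \<Longrightarrow> y k \<in> S" for n y
  proof -
    have "{\<xi>\<in>space M. \<xi> k = y k} \<in> sets M" if "k \<le> n" for k
      using measurable_sets[OF Y_meas, of "{y k}" k] y[OF that]
      by (simp add: vimage_def Int_def conj_commute)
    then have "(\<Inter>k\<in>{..n}. {\<xi>\<in>space M. \<xi> k = y k}) \<in> sets M"
      by (intro sets.finite_INT) auto
    also have "(\<Inter>k\<in>{..n}. {\<xi>\<in>space M. \<xi> k = y k}) = {\<xi>\<in>space M. \<forall>k\<le>n. \<xi> k = y k}"
      by auto
    finally have "measure M {\<xi>\<in>space M. \<forall>k\<le>n. \<xi> k = y k} =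
        measure N (X -` {\<xi>\<in>space M. \<forall>k\<le>n. \<xi> k = y k} \<inter> space N)"
      unfolding M_def by (intro measure_distr) auto
    also have "X -` {\<xi>\<in>space M. \<forall>k\<le>n. \<xi> k = y k} \<inter> space N = {\<omega>\<in>space N. \<forall>k\<le>n. X \<omega> k = y k}"
      using measurable_space[OF X_meas'] by (auto simp: M_def)
    finally show ?thesis .
  qed
  have "markov_chain M S P (\<lambda>n \<xi>. \<xi> n)"
    unfolding markov_chain_def
  proof (intro conjI allI impI Y_meas)
    show "prob_space M"
      unfolding M_def by (rule N.prob_space_distr) (rule X_meas')
    fix n y assume "\<forall>k\<le>Suc n. y k \<in> S"
    then show "measure M {\<xi>\<in>space M. \<forall>k\<le>Suc n. \<xi> k = y k} =
        measure M {\<xi>\<in>space M. \<forall>k\<le>n. \<xi> k = y k} * P n (y n) (y (Suc n))"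
      by (simp add: M_cyl cyl)
  qed
  then show thesis by (rule that)
qed

section \<open>Stationary distributions of Feller processes\<close>

lemma integrable_bcontfun:
  fixes f :: "'a::topological_space \<Rightarrow>\<^sub>C real"
  assumes "\<nu> \<in> space (prob_algebra borel)"
  shows "integrable \<nu> f"
proof -
  interpret prob_space \<nu>
    using assms by (simp add: space_prob_algebra)
  have "apply_bcontfun f \<in> borel_measurable \<nu>"
    using assms by (simp add: space_prob_algebra borel_measurable_continuous_onI cong: measurable_cong_sets)
  then show ?thesis
    by (intro integrable_const_bound[of _ "norm f"]) (auto simp: norm_bounded[of f, simplified])
qed

lemma integral_bcontfun_le:
  fixes f :: "'a::topological_space \<Rightarrow>\<^sub>C real"
  assumes "\<nu> \<in> space (prob_algebra borel)"
  shows "\<bar>\<integral>x. f x \<partial>\<nu>\<bar> \<le> norm f"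
proof -
  interpret prob_space \<nu>
    using assms by (simp add: space_prob_algebra)
  have "\<bar>\<integral>x. f x \<partial>\<nu>\<bar> \<le> (\<integral>x. \<bar>f x\<bar> \<partial>\<nu>)"
    using integral_norm_bound[of \<nu> f] by simp
  also have "\<dots> \<le> (\<integral>x. norm f \<partial>\<nu>)"
    using integrable_bcontfun[OF assms, of f] norm_bounded[of f]
    by (intro integral_mono) auto
  finally show ?thesis
    by (simp add: prob_space)
qed

context
  fixes K :: "real \<Rightarrow> 'a::topological_space \<Rightarrow> 'a measure"
  assumes K: "feller_process K"
begin

lemma kernel_measurable: "0 \<le> t \<Longrightarrow> K t \<in> borel \<rightarrow>\<^sub>M prob_algebra borel"
  using K by (simp add: feller_process_def)

lemma kernel_in: "0 \<le> t \<Longrightarrow> K t x \<in> space (prob_algebra borel)"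
  using measurable_space[OF kernel_measurable] by simp

lemma transition_op_apply: "0 \<le> t \<Longrightarrow> transition_op K t f x = (\<integral>y. f y \<partial>K t x)"
  unfolding transition_op_def
proof (subst Bcontfun_inverse)
  assume "0 \<le> t"
  then have "bounded (range (\<lambda>x. \<integral>y. f y \<partial>K t x))"
    using integral_bcontfun_le[OF kernel_in] by (intro boundedI[of _ "norm f"]) auto
  then show "(\<lambda>x. \<integral>y. f y \<partial>K t x) \<in> bcontfun"
    using K \<open>0 \<le> t\<close> by (simp add: bcontfun_def feller_process_def)
qed simp

lemma transition_op_diff:
  "0 \<le> t \<Longrightarrow> transition_op K t (f - g) = transition_op K t f - transition_op K t g"
  by (intro bcontfun_eqI)
    (simp add: transition_op_apply integrable_bcontfun[OF kernel_in] minus_bcontfun.rep_eq)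

lemma transition_op_scaleR: "0 \<le> t \<Longrightarrow> transition_op K t (c *\<^sub>R f) = c *\<^sub>R transition_op K t f"
  by (intro bcontfun_eqI) (simp add: transition_op_apply scaleR_bcontfun.rep_eq)

lemma norm_transition_op_le: "0 \<le> t \<Longrightarrow> norm (transition_op K t f) \<le> norm f"
  by (intro norm_bound) (simp add: transition_op_apply integral_bcontfun_le kernel_in)

lemma integral_bind_kernel:
  fixes f :: "'a \<Rightarrow>\<^sub>C real"
  assumes "0 \<le> t" "\<nu> \<in> space (prob_algebra borel)"
  shows "(\<integral>x. f x \<partial>(\<nu> \<bind> K t)) = (\<integral>x. transition_op K t f x \<partial>\<nu>)"
proof -
  interpret prob_space \<nu>
    using assms by (simp add: space_prob_algebra)
  have K_sub: "K t \<in> \<nu> \<rightarrow>\<^sub>M subprob_algebra borel"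
    using measurable_prob_algebraD[OF kernel_measurable[OF assms(1)]] assms(2)
    by (simp add: space_prob_algebra cong: measurable_cong_sets)
  have "(\<integral>x. f x \<partial>(\<nu> \<bind> K t)) = (\<integral>x. integral\<^sup>L (K t x) f \<partial>\<nu>)"
  proof (rule integral_bind[where K = borel and B = "norm f" and B' = 1])
    show "apply_bcontfun f \<in> borel_measurable borel"
      by (intro borel_measurable_continuous_onI) simp
    show "AE x in \<nu>. emeasure (K t x) (space (K t x)) \<le> ennreal 1"
      using kernel_in[OF assms(1)]
      by (intro AE_I2) (simp add: space_prob_algebra prob_space.emeasure_space_1)
  qed (use K_sub norm_bounded[of f] in \<open>auto intro: finite_measure_axioms\<close>)
  then show ?thesis
    using assms(1) by (simp add: transition_op_apply)
qed

lemma transition_op_add: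
  assumes "0 \<le> s" "0 \<le> t"
  shows "transition_op K (s + t) f = transition_op K s (transition_op K t f)"
proof (intro bcontfun_eqI)
  fix x
  have "K (s + t) x = K s x \<bind> K t"
    using K assms by (simp add: feller_process_def)
  then show "transition_op K (s + t) f x = transition_op K s (transition_op K t f) x"
    using assms by (simp add: transition_op_apply[of "s + t"] transition_op_apply[of s]
        integral_bind_kernel kernel_in)
qed

lemma transition_op_0: "transition_op K 0 f = f"
proof (intro bcontfun_eqI)
  fix x
  have "K 0 x = return borel x"
    using K by (simp add: feller_process_def)
  then show "transition_op K 0 f x = f x"
    by (simp add: transition_op_apply integral_return borel_measurable_continuous_onI)
qed

text \<open>The semigroup commutes with its own difference quotients and is a contraction, so their
  convergence at \<open>f\<close> carries over to \<open>transition_op K t f\<close>.\<close>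

lemma generator_transition_op:
  assumes fg: "(f, g) \<in> generator K" and "0 \<le> t"
  shows "(transition_op K t f, transition_op K t g) \<in> generator K"
proof -
  let ?T = "transition_op K"
  have lim: "((\<lambda>h. (?T h f - f) /\<^sub>R h - g) \<longlongrightarrow> 0) (at_right 0)"
    using fg LIM_zero by (auto simp: generator_def)
  have "((\<lambda>h. (?T h (?T t f) - ?T t f) /\<^sub>R h - ?T t g) \<longlongrightarrow> 0) (at_right 0)"
  proof (rule Lim_null_comparison[OF _ tendsto_norm_zero[OF lim]])
    show "\<forall>\<^sub>F h in at_right 0. norm ((?T h (?T t f) - ?T t f) /\<^sub>R h - ?T t g)
        \<le> norm ((?T h f - f) /\<^sub>R h - g)"
      using eventually_at_right_less[of "0::real"]
    proof eventually_elim
      case (elim h)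
      have "?T h (?T t f) = ?T t (?T h f)"
        using elim \<open>0 \<le> t\<close> transition_op_add[of h t f] transition_op_add[of t h f]
        by (simp add: add.commute)
      then have "(?T h (?T t f) - ?T t f) /\<^sub>R h - ?T t g = ?T t ((?T h f - f) /\<^sub>R h - g)"
        using \<open>0 \<le> t\<close> by (simp add: transition_op_diff transition_op_scaleR)
      then show ?case
        using norm_transition_op_le[OF \<open>0 \<le> t\<close>] by simp
    qed
  qed
  then show ?thesis
    by (simp add: generator_def LIM_zero_cancel)
qed

text \<open>The increments of \<open>t \<mapsto> \<integral> K\<^sub>t f d\<nu>\<close> over intervals of length \<open>h\<close> are \<open>o(h)\<close> uniformly in \<open>t\<close>.\<close>

lemma integral_transition_op_eq:
  assumes \<nu>: "\<nu> \<in> space (prob_algebra borel)"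
    and zero: "\<And>f g. (f, g) \<in> generator K \<Longrightarrow> (\<integral>x. g x \<partial>\<nu>) = 0"
    and fg: "(f, g) \<in> generator K" and "0 \<le> t"
  shows "(\<integral>x. transition_op K t f x \<partial>\<nu>) = (\<integral>x. f x \<partial>\<nu>)"
proof -
  let ?T = "transition_op K"
  define \<phi> where "\<phi> t = (\<integral>x. ?T t f x \<partial>\<nu>)" for t
  have "\<bar>\<phi> t - \<phi> 0\<bar> \<le> 0 + e" if "0 < e" for e
  proof -
    \<comment> \<open>The increments over an interval of length t add up to at most
      \<open>e' * t\<close>; the summand 1 keeps the quotient meaningful at
      \<open>t = 0\<close>.\<close>
    define e' where "e' = e / (t + 1)"
    have "0 < e'" using that \<open>0 \<le> t\<close> by (simp add: e'_def)
    then have "\<forall>\<^sub>F h in at_right 0. dist ((?T h f - f) /\<^sub>R h) g < e'"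
      using fg tendstoD by (fastforce simp: generator_def)
    then obtain \<delta> where "0 < \<delta>"
      and \<delta>: "\<And>h. 0 < h \<Longrightarrow> h < \<delta> \<Longrightarrow> dist ((?T h f - f) /\<^sub>R h) g < e'"
      by (auto simp: eventually_at_right_field)
    \<comment> \<open>The increment is h times the mean of \<open>?T u\<close> applied to the
      difference quotient of \<open>f\<close>. Its limit \<open>?T u g\<close> lies in the range of
      the generator and has mean 0; contractivity makes the error uniform in u.\<close>
    have step: "\<bar>\<phi> (u + h) - \<phi> u\<bar> \<le> e' * h" if "0 \<le> u" "0 < h" "h < \<delta>" for u h
    proof -
      have "\<phi> (u + h) - \<phi> u = (\<integral>x. ?T u (?T h f - f) x \<partial>\<nu>)"
        using that by (simp add: \<phi>_def transition_op_add transition_op_diff minus_bcontfun.rep_eq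
            integrable_bcontfun[OF \<nu>])
      also have "\<dots> = (\<integral>x. h * (?T u ((?T h f - f) /\<^sub>R h) x - ?T u g x) \<partial>\<nu>) + h * (\<integral>x. ?T u g x \<partial>\<nu>)"
        using that by (simp add: integrable_bcontfun[OF \<nu>] transition_op_scaleR scaleR_bcontfun.rep_eq
            right_diff_distrib)
      also have "(\<integral>x. ?T u g x \<partial>\<nu>) = 0"
        using generator_transition_op[OF fg \<open>0 \<le> u\<close>] by (rule zero)
      also have "(\<integral>x. h * (?T u ((?T h f - f) /\<^sub>R h) x - ?T u g x) \<partial>\<nu>) =
          h * (\<integral>x. ?T u ((?T h f - f) /\<^sub>R h - g) x \<partial>\<nu>)"
        using that by (simp add: transition_op_diff minus_bcontfun.rep_eq)
      finally have "\<bar>\<phi> (u + h) - \<phi> u\<bar> = h * \<bar>\<integral>x. ?T u ((?T h f - f) /\<^sub>R h - g) x \<partial>\<nu>\<bar>"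
        using that by (simp add: abs_mult)
      also have "\<dots> \<le> h * e'"
        using integral_bcontfun_le[OF \<nu>, of "?T u ((?T h f - f) /\<^sub>R h - g)"]
          norm_transition_op_le[OF \<open>0 \<le> u\<close>, of "(?T h f - f) /\<^sub>R h - g"] \<delta>[of h] that
        by (intro mult_left_mono) (auto simp: dist_norm)
      finally show ?thesis by (simp add: mult.commute)
    qed
    show ?thesis
    proof (cases "t = 0")
      case False
      obtain n where n: "t / \<delta> < real n"
        using reals_Archimedean2 by blast
      have "0 < real n"
        using n \<open>0 < \<delta>\<close> \<open>0 \<le> t\<close> by (meson divide_nonneg_pos le_less_trans)
      define h where "h = t / n"
      have h: "0 < h" "h < \<delta>" "n * h = t"
        using n \<open>0 < real n\<close> \<open>0 < \<delta>\<close> \<open>0 \<le> t\<close> False by (auto simp: h_def field_simps)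
      have "\<bar>\<phi> (k * h) - \<phi> 0\<bar> \<le> k * (e' * h)" for k :: nat
      proof (induction k)
        case (Suc k)
        then show ?case
          using step[of "k * h" h] h by (simp add: algebra_simps)
      qed simp
      from this[of n] have "\<bar>\<phi> t - \<phi> 0\<bar> \<le> e' * t"
        using h by (simp add: algebra_simps)
      also have "\<dots> \<le> e"
        using \<open>0 < e\<close> \<open>0 \<le> t\<close> by (simp add: e'_def field_simps)
      finally show ?thesis by simp
    qed (use that in simp)
  qed
  then have "\<bar>\<phi> t - \<phi> 0\<bar> \<le> 0"
    by (rule field_le_epsilon)
  then show ?thesis
    by (simp add: \<phi>_def transition_op_0)
qed

end

section \<open>Finitely determined functions and cluster points of means\<close>

lemma finitely_determined_const [simp]: "finitely_determined (\<lambda>_. c)"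
  unfolding finitely_determined_def by auto

lemma finitely_determined_coordinate: "finitely_determined (\<lambda>x. x i)"
  unfolding finitely_determined_def by (rule exI[of _ "{i}"]) auto

lemma finitely_determined_comp: "finitely_determined f \<Longrightarrow> finitely_determined (\<lambda>x. h (f x))"
  unfolding finitely_determined_def by metis

lemma finitely_determined_comp2:
  assumes "finitely_determined f" "finitely_determined g"
  shows "finitely_determined (\<lambda>x. h (f x) (g x))"
proof -
  obtain A B where "finite A" "\<And>x y. (\<forall>i\<in>A. x i = y i) \<Longrightarrow> f x = f y"
      "finite B" "\<And>x y. (\<forall>i\<in>B. x i = y i) \<Longrightarrow> g x = g y"
    using assms unfolding finitely_determined_def by metis
  then show ?thesis
    unfolding finitely_determined_def by (intro exI[of _ "A \<union> B"]) (metis UnCI finite_UnI)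
qed

lemma finitely_determined_sum:
  "(\<And>a. a \<in> A \<Longrightarrow> finitely_determined (f a)) \<Longrightarrow> finitely_determined (\<lambda>x. \<Sum>a\<in>A. f a x)"
  by (induction A rule: infinite_finite_induct) (auto intro: finitely_determined_comp2)

lemma finite_range_finitely_determined:
  fixes f :: "('i \<Rightarrow> bool) \<Rightarrow> 'b"
  assumes "finitely_determined f"
  shows "finite (range f)"
proof -
  obtain A where "finite A" and A: "\<And>x y. (\<forall>i\<in>A. x i = y i) \<Longrightarrow> f x = f y"
    using assms unfolding finitely_determined_def by metis
  \<comment> \<open>Every configuration may be replaced by the one that agrees with it on
    \<open>A\<close> and is \<open>False\<close> elsewhere.\<close>
  have "range f \<subseteq> (\<lambda>B. f (\<lambda>i. i \<in> B)) ` Pow A"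
  proof
    fix v assume "v \<in> range f"
    then obtain x where "v = f x" by blast
    also have "\<dots> = f (\<lambda>i. i \<in> {i\<in>A. x i})"
      by (rule A) auto
    finally show "v \<in> (\<lambda>B. f (\<lambda>i. i \<in> B)) ` Pow A" by blast
  qed
  then show ?thesis
    using \<open>finite A\<close> by (meson finite_Pow_iff finite_imageI finite_subset)
qed

lemma finitely_determined_bounded:
  fixes f :: "('i \<Rightarrow> bool) \<Rightarrow> real"
  assumes "finitely_determined f"
  obtains C where "\<And>x. \<bar>f x\<bar> \<le> C"
  using finite_imp_bounded[OF finite_range_finitely_determined[OF assms]]
  by (auto simp: bounded_iff)

section \<open>Cylinder sets: a clopen algebra generating the Borel sets\<close>

definition cylinders :: "('i \<Rightarrow> bool) set set" where
  "cylinders = {A. finitely_determined (\<lambda>x. x \<in> A)}"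

lemma cylinders_Compl: "A \<in> cylinders \<Longrightarrow> - A \<in> cylinders"
  using finitely_determined_comp[of "\<lambda>x. x \<in> A" Not] by (simp add: cylinders_def)

lemma cylinders_Un: "A \<in> cylinders \<Longrightarrow> B \<in> cylinders \<Longrightarrow> A \<union> B \<in> cylinders"
  using finitely_determined_comp2[of "\<lambda>x. x \<in> A" "\<lambda>x. x \<in> B" "(\<or>)"] by (simp add: cylinders_def)

lemma algebra_cylinders: "algebra UNIV cylinders"
  by (intro algebra_iff_Un[THEN iffD2])
    (auto simp: cylinders_Un Compl_eq_Diff_UNIV[symmetric] cylinders_Compl, simp add: cylinders_def)

lemma level_set_cylinder: "finitely_determined f \<Longrightarrow> f -` V \<in> cylinders"
  using finitely_determined_comp[of f "\<lambda>v. v \<in> V"] by (simp add: cylinders_def)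

lemma open_cylinder:
  assumes "A \<in> cylinders"
  shows "open (A :: ('i \<Rightarrow> bool) set)"
proof -
  obtain J where J: "finite J" "\<And>x y. (\<forall>i\<in>J. x i = y i) \<Longrightarrow> x \<in> A \<longleftrightarrow> y \<in> A"
    using assms unfolding cylinders_def finitely_determined_def by auto
  show ?thesis
    unfolding open_subopen[of A]
  proof
    fix x assume "x \<in> A"
    show "\<exists>T. open T \<and> x \<in> T \<and> T \<subseteq> A"
    proof (intro exI conjI)
      show "open {y. \<forall>i\<in>J. y i \<in> {x i}}"
        using J(1) by (intro product_topology_basis'[of J "\<lambda>i. {x i}" "\<lambda>i. i"]) (simp_all add: discrete_topology_class.open_discrete)
    qed (use J(2) \<open>x \<in> A\<close> in auto)
  qed
qed

lemma closed_cylinder: "A \<in> cylinders \<Longrightarrow> closed (A :: ('i \<Rightarrow> bool) set)"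
  using open_cylinder[OF cylinders_Compl] by (simp add: closed_def)

lemma continuous_finitely_determined:
  fixes f :: "('i \<Rightarrow> bool) \<Rightarrow> 'b::topological_space"
  shows "finitely_determined f \<Longrightarrow> continuous_on UNIV f"
  by (auto simp: continuous_on_open_vimage intro: open_cylinder level_set_cylinder)

lemma compact_bool_functions: "compact (UNIV :: ('i \<Rightarrow> bool) set)"
proof -
  have "compactin (product_topology (\<lambda>_::'i. euclidean :: bool topology) UNIV) (PiE UNIV (\<lambda>_. UNIV))"
    unfolding compactin_PiE by (simp add: finite_imp_compact)
  then show ?thesis
    by (simp add: euclidean_product_topology)
qed

lemma sigma_sets_cylinders: "sigma_sets UNIV cylinders = sets (borel :: ('i::countable \<Rightarrow> bool) measure)"
proof
  show "sigma_sets UNIV cylinders \<subseteq> sets (borel :: ('i \<Rightarrow> bool) measure)"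
    using sets.sigma_sets_subset[of cylinders "borel :: ('i \<Rightarrow> bool) measure"] open_cylinder
    by (metis borel_open space_borel subsetI)
next
  have "sets (borel :: ('i \<Rightarrow> bool) measure) = sets (PiM UNIV (\<lambda>_. borel))"
    by (rule sets_PiM_equal_borel[symmetric])
  also have "\<dots> \<subseteq> sigma_sets UNIV cylinders"
    unfolding sets_PiM_single
  proof (simp add: PiE_UNIV_domain, intro sigma_sets_mono subsetI)
    fix E :: "('i \<Rightarrow> bool) set"
    assume "E \<in> {{f. f i \<in> A} |i A. A \<in> sets borel}"
    then show "E \<in> sigma_sets UNIV cylinders"
      using finitely_determined_comp[OF finitely_determined_coordinate]
      by (auto simp: cylinders_def intro!: sigma_sets.Basic)
  qed
  finally show "sets (borel :: ('i \<Rightarrow> bool) measure) \<subseteq> sigma_sets UNIV cylinders" .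
qed

text \<open>Defined on all functions, without measurability: a finitely additive probability.
  Stationary means of the game have this form, and countable additivity is recovered only in the
  limit.\<close>

definition mean_functional :: "(('a \<Rightarrow> real) \<Rightarrow> real) \<Rightarrow> bool" where
  "mean_functional \<Lambda> \<longleftrightarrow>
     (\<forall>f g. \<Lambda> (\<lambda>x. f x + g x) = \<Lambda> f + \<Lambda> g) \<and> (\<forall>c f. \<Lambda> (\<lambda>x. c * f x) = c * \<Lambda> f) \<and>
     (\<forall>f. (\<forall>x. 0 \<le> f x) \<longrightarrow> 0 \<le> \<Lambda> f) \<and> \<Lambda> (\<lambda>_. 1) = 1"

lemma mean_functional_indicator:
  assumes "mean_functional \<Lambda>"
  shows "0 \<le> \<Lambda> (indicator A)" "\<Lambda> (indicator A) \<le> 1"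
    and "A \<inter> B = {} \<Longrightarrow> \<Lambda> (indicator (A \<union> B)) = \<Lambda> (indicator A) + \<Lambda> (indicator B)"
proof -
  have add: "\<Lambda> (indicator (A \<union> B)) = \<Lambda> (indicator A) + \<Lambda> (indicator B)" if "A \<inter> B = {}" for A B
  proof -
    have "(indicator (A \<union> B) :: _ \<Rightarrow> real) = (\<lambda>x. indicator A x + indicator B x)"
      using that by (auto simp: indicator_def fun_eq_iff)
    then show ?thesis
      using assms by (simp add: mean_functional_def)
  qed
  have nonneg: "0 \<le> \<Lambda> (indicator A)" for A
    using assms by (simp add: mean_functional_def)
  have "\<Lambda> (indicator A) + \<Lambda> (indicator (- A)) = \<Lambda> (\<lambda>_. 1)"
    using add[of A "- A"] by (simp add: indicator_def[abs_def])
  moreover have "\<Lambda> (\<lambda>_. 1) = 1"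
    using assms by (simp add: mean_functional_def)
  ultimately show "\<Lambda> (indicator A) \<le> 1"
    using nonneg[of "- A"] by linarith
  show "0 \<le> \<Lambda> (indicator A)" by (rule nonneg)
  show "A \<inter> B = {} \<Longrightarrow> \<Lambda> (indicator (A \<union> B)) = \<Lambda> (indicator A) + \<Lambda> (indicator B)"
    by (rule add)
qed

lemma mean_functional_sum:
  assumes "mean_functional \<Lambda>"
  shows "\<Lambda> (\<lambda>x. \<Sum>a\<in>A. f a x) = (\<Sum>a\<in>A. \<Lambda> (f a))"
proof -
  have add: "\<Lambda> (\<lambda>x. g x + h x) = \<Lambda> g + \<Lambda> h" for g h
    using assms unfolding mean_functional_def by blast
  have scale: "\<Lambda> (\<lambda>x. c * g x) = c * \<Lambda> g" for c g
    using assms unfolding mean_functional_def by blast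
  have zero: "\<Lambda> (\<lambda>_. 0) = 0"
    using scale[of 0 "\<lambda>_. 0"] by simp
  show ?thesis
    by (induction A rule: infinite_finite_induct) (simp_all add: zero add)
qed

lemma finite_range_decomposition:
  fixes f :: "'a \<Rightarrow> real"
  assumes "finite (range f)"
  shows "f x = (\<Sum>v\<in>range f. v * indicator (f -` {v}) x)"
proof -
  have "(\<Sum>v\<in>range f. v * indicator (f -` {v}) x) = (\<Sum>v\<in>range f. if v = f x then v else 0)"
    by (intro sum.cong) (auto simp: indicator_def)
  then show ?thesis
    using assms by simp
qed

text \<open>Countable additivity comes for free: by compactness, a decreasing sequence of cylinders with empty
  intersection is eventually empty.\<close>

lemma measure_from_cylinders:
  fixes a :: "('i::countable \<Rightarrow> bool) set \<Rightarrow> real"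
  assumes nonneg: "\<And>A. 0 \<le> a A" and UNIV: "a UNIV = 1"
    and add: "\<And>A B. A \<in> cylinders \<Longrightarrow> B \<in> cylinders \<Longrightarrow> A \<inter> B = {} \<Longrightarrow> a (A \<union> B) = a A + a B"
  obtains \<nu> where "\<nu> \<in> space (prob_algebra borel)" "\<And>A. A \<in> cylinders \<Longrightarrow> measure \<nu> A = a A"
proof -
  interpret algebra UNIV "cylinders :: ('i \<Rightarrow> bool) set set"
    by (rule algebra_cylinders)
  have "a {} = 0"
    using add[of "{}" "{}"] by simp
  have "\<exists>\<mu> :: ('i \<Rightarrow> bool) set \<Rightarrow> ennreal. (\<forall>A\<in>cylinders. \<mu> A = ennreal (a A)) \<and>
      measure_space UNIV (sigma_sets UNIV cylinders) \<mu>"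
  proof (rule caratheodory_empty_continuous)
    show "positive cylinders (\<lambda>A. ennreal (a A))"
      using \<open>a {} = 0\<close> by (simp add: positive_def)
    show "Measure_Space.additive cylinders (\<lambda>A. ennreal (a A))"
      using add nonneg by (auto simp: Measure_Space.additive_def)
    fix A :: "nat \<Rightarrow> ('i \<Rightarrow> bool) set"
    assume A: "range A \<subseteq> cylinders" "decseq A" "(\<Inter>i. A i) = {}"
    have "\<exists>n. A n = {}"
    proof (rule ccontr)
      assume "\<nexists>n. A n = {}"
      have "UNIV \<inter> (\<Inter>i\<in>UNIV. A i) \<noteq> {}"
      proof (rule compact_imp_fip_image[OF compact_bool_functions])
        show "closed (A i)" for i
          using A(1) by (intro closed_cylinder) auto
        fix I :: "nat set" assume "finite I"
        then obtain n where "\<And>i. i \<in> I \<Longrightarrow> i \<le> n"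
          by (meson finite_nat_set_iff_bounded_le)
        then have "A n \<subseteq> (\<Inter>i\<in>I. A i)"
          using A(2) by (auto simp: decseq_def)
        then show "UNIV \<inter> (\<Inter>i\<in>I. A i) \<noteq> {}"
          using \<open>\<nexists>n. A n = {}\<close> by auto
      qed
      then show False using A(3) by simp
    qed
    then obtain n where "A n = {}" by blast
    then have "\<forall>\<^sub>F m in sequentially. A m = {}"
      using A(2) unfolding decseq_def eventually_sequentially by blast
    then have "\<forall>\<^sub>F m in sequentially. ennreal (a (A m)) = 0"
      by eventually_elim (simp add: \<open>a {} = 0\<close>)
    then show "(\<lambda>m. ennreal (a (A m))) \<longlonglongrightarrow> 0"
      by (rule tendsto_eventually)
  qed simp
  then obtain \<mu> :: "('i \<Rightarrow> bool) set \<Rightarrow> ennreal" where \<mu>: "\<And>A. A \<in> cylinders \<Longrightarrow> \<mu> A = ennreal (a A)"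
    and \<mu>_space: "measure_space UNIV (sigma_sets UNIV cylinders) \<mu>"
    by blast
  define \<nu> where "\<nu> = measure_of UNIV cylinders \<mu>"
  have emeasure: "emeasure \<nu> A = ennreal (a A)" if "A \<in> cylinders" for A
    using \<mu>_space that emeasure_measure_of[OF \<nu>_def, of A]
    by (auto simp: measure_space_def \<mu> \<nu>_def)
  have sets: "sets \<nu> = sets borel"
    by (simp add: \<nu>_def sigma_sets_cylinders)
  have "UNIV \<in> (cylinders :: ('i \<Rightarrow> bool) set set)"
    by (simp add: cylinders_def)
  then have "prob_space \<nu>"
    using emeasure[of UNIV] UNIV by (intro prob_spaceI) (simp add: \<nu>_def space_measure_of_conv)
  show thesis
    by (rule that[of \<nu>])
      (use \<open>prob_space \<nu>\<close> sets emeasure nonneg in \<open>simp_all add: space_prob_algebra measure_def\<close>)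
qed

text \<open>By Tychonoff the values on all sets have a cluster point in a power of the unit
  interval. That power is uncountable, so subsequences need not exist, and a finer filter
  \<open>G\<close> plays their part.\<close>

lemma mean_functionals_cluster:
  fixes \<Lambda> :: "'n \<Rightarrow> (('i::countable \<Rightarrow> bool) \<Rightarrow> real) \<Rightarrow> real"
  assumes "F \<noteq> bot" and mean: "\<forall>\<^sub>F N in F. mean_functional (\<Lambda> N)"
  obtains \<nu> G where "\<nu> \<in> space (prob_algebra borel)" "G \<noteq> bot" "G \<le> F"
    "\<And>f. finitely_determined f \<Longrightarrow> ((\<lambda>N. \<Lambda> N f) \<longlongrightarrow> (\<integral>x. f x \<partial>\<nu>)) G"
proof -
  \<comment> \<open>The default 0 keeps \<open>u N\<close> in the cube \<open>C\<close> even where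
    \<open>\<Lambda> N\<close> is not a mean.\<close>
  define u where "u N A = (if mean_functional (\<Lambda> N) then \<Lambda> N (indicator A) else 0)"
    for N and A :: "('i \<Rightarrow> bool) set"
  define C where "C = (PiE UNIV (\<lambda>_. {0..1}) :: (('i \<Rightarrow> bool) set \<Rightarrow> real) set)"
  have "compactin (product_topology (\<lambda>_. euclidean) UNIV) C"
    unfolding C_def compactin_PiE by simp
  then have "compact C"
    by (simp add: euclidean_product_topology)
  moreover have "\<forall>\<^sub>F y in filtermap u F. y \<in> C"
    by (simp add: eventually_filtermap C_def u_def PiE_UNIV_domain mean_functional_indicator)
  moreover have "filtermap u F \<noteq> bot"
    using \<open>F \<noteq> bot\<close> by (simp add: filtermap_bot_iff)
  ultimately obtain a where "a \<in> C" and cluster: "inf (nhds a) (filtermap u F) \<noteq> bot"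
    unfolding compact_filter by blast
  \<comment> \<open>The largest filter below \<open>F\<close> along which \<open>u\<close> tends to
    \<open>a\<close>; it is proper exactly because \<open>a\<close> is a cluster point.\<close>
  define G where "G = inf F (filtercomap u (nhds a))"
  have "G \<noteq> bot"
  proof
    assume "G = bot"
    then obtain P Q where PQ: "eventually P F" "eventually Q (nhds a)" "\<And>N. P N \<Longrightarrow> \<not> Q (u N)"
      unfolding G_def trivial_limit_def eventually_inf eventually_filtercomap by metis
    have "eventually (\<lambda>y. \<not> Q y) (filtermap u F)"
      using PQ(1) unfolding eventually_filtermap by eventually_elim (rule PQ(3))
    then have "eventually (\<lambda>_. False) (inf (nhds a) (filtermap u F))"
      using PQ(2) unfolding eventually_inf by blast
    then show False
      using cluster by (simp add: trivial_limit_def)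
  qed
  have "G \<le> F" by (simp add: G_def)
  have "filterlim u (nhds a) G"
    by (rule filterlim_mono[OF filterlim_filtercomap order_refl]) (simp add: G_def)
  then have u_lim: "((\<lambda>N. u N A) \<longlongrightarrow> a A) G" for A
    using continuous_on_product_coordinates[of A]
    by (intro continuous_on_tendsto_compose[of UNIV "\<lambda>x. x A" u a G]) auto
  have mean_G: "\<forall>\<^sub>F N in G. mean_functional (\<Lambda> N)"
    using mean \<open>G \<le> F\<close> by (rule filter_leD[rotated])
  have lim: "((\<lambda>N. \<Lambda> N (indicator A)) \<longlongrightarrow> a A) G" for A
    using u_lim[of A]
    by (rule Lim_transform_eventually) (use mean_G in \<open>eventually_elim, simp add: u_def\<close>)
  have a_UNIV: "a UNIV = 1"
  proof (rule tendsto_unique[OF \<open>G \<noteq> bot\<close> lim])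
    show "((\<lambda>N. \<Lambda> N (indicator UNIV)) \<longlongrightarrow> 1) G"
      by (rule tendsto_eventually)
        (use mean_G in \<open>eventually_elim, simp add: mean_functional_def indicator_def[abs_def]\<close>)
  qed
  have a_add: "a (A \<union> B) = a A + a B" if "A \<inter> B = {}" for A B
  proof (rule tendsto_unique[OF \<open>G \<noteq> bot\<close> lim])
    show "((\<lambda>N. \<Lambda> N (indicator (A \<union> B))) \<longlongrightarrow> a A + a B) G"
      by (rule Lim_transform_eventually[OF tendsto_add[OF lim[of A] lim[of B]]])
        (use mean_G in \<open>eventually_elim, simp add: mean_functional_indicator(3)[OF _ that]\<close>)
  qed
  have a_nonneg: "0 \<le> a A" for A
    using \<open>a \<in> C\<close> by (auto simp: C_def PiE_UNIV_domain)
  obtain \<nu> where \<nu>: "\<nu> \<in> space (prob_algebra borel)"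
    and \<nu>_cyl: "\<And>A. A \<in> cylinders \<Longrightarrow> measure \<nu> A = a A"
    by (rule measure_from_cylinders[of a, OF a_nonneg a_UNIV]) (blast intro: a_add)+
  interpret prob_space \<nu>
    using \<nu> by (simp add: space_prob_algebra)
  have sets_\<nu>: "A \<in> sets \<nu>" if "A \<in> cylinders" for A
    using \<nu> open_cylinder[OF that] by (simp add: space_prob_algebra)
  have "((\<lambda>N. \<Lambda> N f) \<longlongrightarrow> (\<integral>x. f x \<partial>\<nu>)) G" if f: "finitely_determined f" for f
  proof -
    note fin = finite_range_finitely_determined[OF f]
    have "(\<integral>x. f x \<partial>\<nu>) = (\<integral>x. (\<Sum>v\<in>range f. v * indicator (f -` {v}) x) \<partial>\<nu>)"
      by (intro Bochner_Integration.integral_cong refl finite_range_decomposition fin)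
    also have "\<dots> = (\<Sum>v\<in>range f. \<integral>x. v * indicator (f -` {v}) x \<partial>\<nu>)"
      using level_set_cylinder[OF f] sets_\<nu>
      by (intro Bochner_Integration.integral_sum integrable_mult_right integrable_real_indicator)
        (auto simp: emeasure_eq_measure)
    also have "\<dots> = (\<Sum>v\<in>range f. v * a (f -` {v}))"
      using level_set_cylinder[OF f] sets_\<nu> sets.sets_into_space[OF sets_\<nu>]
      by (intro sum.cong) (auto simp: Int_absorb2 \<nu>_cyl)
    finally have int: "(\<integral>x. f x \<partial>\<nu>) = (\<Sum>v\<in>range f. v * a (f -` {v}))" .
    show ?thesis
    proof (rule Lim_transform_eventually)
      show "((\<lambda>N. \<Sum>v\<in>range f. v * \<Lambda> N (indicator (f -` {v}))) \<longlongrightarrow> (\<integral>x. f x \<partial>\<nu>)) G"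
        unfolding int by (intro tendsto_intros lim)
      show "\<forall>\<^sub>F N in G. (\<Sum>v\<in>range f. v * \<Lambda> N (indicator (f -` {v}))) = \<Lambda> N f"
        using mean_G
      proof eventually_elim
        case (elim N)
        have "\<Lambda> N f = \<Lambda> N (\<lambda>x. \<Sum>v\<in>range f. v * indicator (f -` {v}) x)"
          by (intro arg_cong[where f = "\<Lambda> N"] ext finite_range_decomposition fin)
        also have "\<dots> = (\<Sum>v\<in>range f. \<Lambda> N (\<lambda>x. v * indicator (f -` {v}) x))"
          using mean_functional_sum[OF elim] .
        also have "\<dots> = (\<Sum>v\<in>range f. v * \<Lambda> N (indicator (f -` {v})))"
          using elim by (simp add: mean_functional_def)
        finally show ?case by simp
      qed
    qed
  qed
  then show thesis
    using \<nu> \<open>G \<noteq> bot\<close> \<open>G \<le> F\<close> that by blast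
qed

section \<open>The generator of the spin system\<close>

definition spin_gen :: "(nat \<Rightarrow> real) \<Rightarrow> ((int \<Rightarrow> bool) \<Rightarrow> real) \<Rightarrow> (int \<Rightarrow> bool) \<Rightarrow> real" where
  "spin_gen p f x = (\<Sum>\<^sub>\<infinity>i\<in>UNIV. flip_rate p i x * (f (flip i x) - f x))"

lemma spin_gen_finite_sum:
  assumes "finite A" and A: "\<And>x y. (\<forall>i\<in>A. x i = y i) \<Longrightarrow> f x = f y"
  shows "spin_gen p f x = (\<Sum>i\<in>A. flip_rate p i x * (f (flip i x) - f x))"
proof -
  have "f (flip i x) = f x" if "i \<notin> A" for i
    using that by (intro A) (auto simp: flip_def)
  then have "spin_gen p f x = (\<Sum>\<^sub>\<infinity>i\<in>A. flip_rate p i x * (f (flip i x) - f x))"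
    unfolding spin_gen_def by (intro infsum_cong_neutral) auto
  then show ?thesis
    using \<open>finite A\<close> by simp
qed

lemma finitely_determined_flip_rate: "finitely_determined (flip_rate p i)"
  unfolding finitely_determined_def
  by (rule exI[of _ "{i - 1, i, i + 1}"]) (auto simp: flip_rate_def)

lemma finitely_determined_flip:
  assumes "finitely_determined f"
  shows "finitely_determined (\<lambda>x. f (flip i x))"
proof -
  obtain A where "finite A" "\<And>x y. (\<forall>i\<in>A. x i = y i) \<Longrightarrow> f x = f y"
    using assms unfolding finitely_determined_def by metis
  then show ?thesis
    unfolding finitely_determined_def by (intro exI[of _ A]) (auto simp: flip_def)
qed

lemma finitely_determined_spin_gen:
  assumes "finitely_determined f"
  shows "finitely_determined (spin_gen p f)"
proof -
  obtain A where "finite A" "\<And>x y. (\<forall>i\<in>A. x i = y i) \<Longrightarrow> f x = f y"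
    using assms unfolding finitely_determined_def by metis
  then have "spin_gen p f = (\<lambda>x. \<Sum>i\<in>A. flip_rate p i x * (f (flip i x) - f x))"
    using spin_gen_finite_sum by blast
  then show ?thesis
    using assms by (auto intro!: finitely_determined_sum finitely_determined_comp2[of _ _ "(*)"]
        finitely_determined_comp2[of _ _ "(-)"] finitely_determined_flip finitely_determined_flip_rate)
qed

lemma finitely_determined_bcontfun:
  fixes f :: "('i \<Rightarrow> bool) \<Rightarrow> real"
  assumes "finitely_determined f"
  shows "f \<in> bcontfun"
  using continuous_finitely_determined[OF assms] finite_range_finitely_determined[OF assms]
  by (simp add: bcontfun_def finite_imp_bounded)

text \<open>Integration against a probability is continuous in the supremum norm, so mean zero
  passes to limits of the images.\<close>

lemma spin_pregenerator_closure_integral: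
  assumes \<nu>: "\<nu> \<in> space (prob_algebra borel)"
    and zero: "\<And>f. finitely_determined f \<Longrightarrow> (\<integral>x. spin_gen p f x \<partial>\<nu>) = 0"
    and fg: "(f, g) \<in> closure (spin_pregenerator p)"
  shows "(\<integral>x. g x \<partial>\<nu>) = 0"
proof -
  obtain z where z: "\<And>n. z n \<in> spin_pregenerator p" "z \<longlonglongrightarrow> (f, g)"
    using fg unfolding closure_sequential by blast
  have "(\<integral>x. snd (z n) x \<partial>\<nu>) = 0" for n
  proof -
    obtain f' g' where z_n: "z n = (f', g')" by fastforce
    then have "finitely_determined (apply_bcontfun f')"
      and "apply_bcontfun g' = spin_gen p (apply_bcontfun f')"
      using z(1)[of n] by (auto simp: spin_pregenerator_def spin_gen_def[abs_def] fun_eq_iff)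
    then show ?thesis
      using zero z_n by simp
  qed
  then have le: "\<bar>\<integral>x. g x \<partial>\<nu>\<bar> \<le> norm (snd (z n) - g)" for n
    using integral_bcontfun_le[OF \<nu>, of "snd (z n) - g"]
    by (simp add: minus_bcontfun.rep_eq integrable_bcontfun[OF \<nu>])
  have "(\<lambda>n. norm (snd (z n) - g)) \<longlonglongrightarrow> 0"
    using tendsto_snd[OF z(2)] by (auto simp: tendsto_norm_zero_iff LIM_zero_iff)
  then have "\<bar>\<integral>x. g x \<partial>\<nu>\<bar> \<le> 0"
    by (rule LIMSEQ_le_const) (use le in auto)
  then show ?thesis by simp
qed

text \<open>Indicators of cylinders are themselves finitely determined, hence lie in the domain of
  the generator, and cylinders form an intersection-stable generating class; preserving their means
  determines the whole law.\<close>

lemma stationary_spin_system: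
  assumes K: "spin_system p K" and \<nu>: "\<nu> \<in> space (prob_algebra borel)"
    and zero: "\<And>f. finitely_determined f \<Longrightarrow> (\<integral>x. spin_gen p f x \<partial>\<nu>) = 0"
  shows "stationary_distribution K \<nu>"
  unfolding stationary_distribution_def
proof (intro conjI allI impI \<nu>)
  fix t :: real assume "0 \<le> t"
  have feller: "feller_process K" and gen: "generator K = closure (spin_pregenerator p)"
    using K by (auto simp: spin_system_def)
  have bind: "\<nu> \<bind> K t \<in> space (prob_algebra borel)"
    using measurable_space[OF measurable_bind_prob_space[OF measurable_const[OF \<nu>] kernel_measurable[OF feller \<open>0 \<le> t\<close>]]]
    by (metis UNIV_I space_borel)
  interpret \<nu>: prob_space \<nu>
    using \<nu> by (simp add: space_prob_algebra)
  interpret bind: prob_space "\<nu> \<bind> K t"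
    using bind by (simp add: space_prob_algebra)
  show "\<nu> \<bind> K t = \<nu>"
  proof (rule measure_eqI_generator_eq[where E = cylinders and \<Omega> = UNIV and A = "\<lambda>_. UNIV"])
    show "Int_stable (cylinders :: (int \<Rightarrow> bool) set set)"
      using algebra.Int_stable[OF algebra_cylinders] .
    show "sets (\<nu> \<bind> K t) = sigma_sets UNIV cylinders" "sets \<nu> = sigma_sets UNIV cylinders"
      using \<nu> bind by (simp_all add: sigma_sets_cylinders space_prob_algebra)
    fix A :: "(int \<Rightarrow> bool) set" assume A: "A \<in> cylinders"
    have fd: "finitely_determined (indicator A :: _ \<Rightarrow> real)"
      using A finitely_determined_comp[of "\<lambda>x. x \<in> A" of_bool]
      by (simp add: cylinders_def indicator_def[abs_def])
    define f where "f = Bcontfun (indicator A :: _ \<Rightarrow> real)"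
    define g where "g = Bcontfun (spin_gen p (indicator A))"
    have f: "apply_bcontfun f = indicator A"
      by (simp add: f_def Bcontfun_inverse finitely_determined_bcontfun fd)
    have g: "apply_bcontfun g = spin_gen p (indicator A)"
      by (simp add: g_def Bcontfun_inverse finitely_determined_bcontfun finitely_determined_spin_gen fd)
    have "(f, g) \<in> spin_pregenerator p"
      using fd by (simp add: spin_pregenerator_def f g spin_gen_def)
    then have fg: "(f, g) \<in> generator K"
      unfolding gen using closure_subset by blast
    have "(\<integral>x. f x \<partial>(\<nu> \<bind> K t)) = (\<integral>x. transition_op K t f x \<partial>\<nu>)"
      by (rule integral_bind_kernel[OF feller \<open>0 \<le> t\<close> \<nu>])
    also have "\<dots> = (\<integral>x. f x \<partial>\<nu>)"
    proof (rule integral_transition_op_eq[OF feller \<nu> _ fg \<open>0 \<le> t\<close>])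
      fix f g assume "(f, g) \<in> generator K"
      then show "(\<integral>x. g x \<partial>\<nu>) = 0"
        unfolding gen by (rule spin_pregenerator_closure_integral[OF \<nu>, rotated]) (rule zero)
    qed
    finally have "measure (\<nu> \<bind> K t) A = measure \<nu> A"
      using \<nu> bind by (simp add: f space_prob_algebra sets_eq_imp_space_eq[of _ borel])
    then show "emeasure (\<nu> \<bind> K t) A = emeasure \<nu> A"
      by (simp add: \<nu>.emeasure_eq_measure bind.emeasure_eq_measure)
  qed (auto simp: cylinders_def)
qed

text \<open>Compactness plus uniqueness: if convergence failed, \<open>F\<close> could be restricted
  to the indices where the mean of \<open>f\<close> stays \<open>e\<close> away from its target, yet
  a cluster point taken there would again be \<pi>.\<close>

lemma mean_functionals_converge_to_stationary:
  assumes K: "spin_system p K" and erg: "ergodic_with K \<pi>"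
    and mean: "\<forall>\<^sub>F N in F. mean_functional (\<Lambda> N)"
    and gen: "\<And>f. finitely_determined f \<Longrightarrow> ((\<lambda>N. \<Lambda> N (spin_gen p f)) \<longlongrightarrow> 0) F"
    and f: "finitely_determined f"
  shows "((\<lambda>N. \<Lambda> N f) \<longlongrightarrow> (\<integral>x. f x \<partial>\<pi>)) F"
proof (rule ccontr)
  assume "\<not> ?thesis"
  then obtain e where "0 < e" and bad: "\<not> (\<forall>\<^sub>F N in F. dist (\<Lambda> N f) (\<integral>x. f x \<partial>\<pi>) < e)"
    by (auto simp: tendsto_iff)
  define F' where "F' = inf F (principal {N. \<not> dist (\<Lambda> N f) (\<integral>x. f x \<partial>\<pi>) < e})"
  have "F' \<noteq> bot"
    using bad by (auto simp: F'_def trivial_limit_def eventually_inf_principal)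
  have "F' \<le> F" by (simp add: F'_def)
  then have "\<forall>\<^sub>F N in F'. mean_functional (\<Lambda> N)"
    using mean by (rule filter_leD)
  with \<open>F' \<noteq> bot\<close> obtain \<nu> G where \<nu>: "\<nu> \<in> space (prob_algebra borel)" and G: "G \<noteq> bot" "G \<le> F'"
    and lim: "\<And>f. finitely_determined f \<Longrightarrow> ((\<lambda>N. \<Lambda> N f) \<longlongrightarrow> (\<integral>x. f x \<partial>\<nu>)) G"
    by (rule mean_functionals_cluster) blast
  have "(\<integral>x. spin_gen p f x \<partial>\<nu>) = 0" if "finitely_determined f" for f
  proof (rule tendsto_unique[OF \<open>G \<noteq> bot\<close> lim[OF finitely_determined_spin_gen[OF that]]])
    show "((\<lambda>N. \<Lambda> N (spin_gen p f)) \<longlongrightarrow> 0) G"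
      using gen[OF that] \<open>G \<le> F'\<close> \<open>F' \<le> F\<close> by (meson order_trans tendsto_mono)
  qed
  then have "stationary_distribution K \<nu>"
    by (rule stationary_spin_system[OF K \<nu>])
  then have "\<nu> = \<pi>"
    using erg by (simp add: ergodic_with_def)
  then have "\<forall>\<^sub>F N in G. dist (\<Lambda> N f) (\<integral>x. f x \<partial>\<pi>) < e"
    using lim[OF f] \<open>0 < e\<close> by (auto dest: tendstoD)
  moreover have "\<forall>\<^sub>F N in G. \<not> dist (\<Lambda> N f) (\<integral>x. f x \<partial>\<pi>) < e"
    using G(2) by (rule filter_leD) (simp add: F'_def eventually_inf_principal)
  ultimately have "\<forall>\<^sub>F N in G. False"
    by eventually_elim simp
  then show False
    using \<open>G \<noteq> bot\<close> by (simp add: trivial_limit_def)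
qed

section \<open>Periodic chains\<close>

locale periodic_chain =
  fixes S :: "'s set" and P :: "nat \<Rightarrow> 's \<Rightarrow> 's \<Rightarrow> real" and d :: nat
  assumes finite_S: "finite S" and S_ne: "S \<noteq> {}"
    and P_nonneg: "x \<in> S \<Longrightarrow> y \<in> S \<Longrightarrow> 0 \<le> P n x y"
    and P_sum: "x \<in> S \<Longrightarrow> (\<Sum>y\<in>S. P n x y) = 1"
    and d_pos: "0 < d"
    and P_mod: "P (n mod d) = P n"
begin

definition step :: "nat \<Rightarrow> ('s \<Rightarrow> real) \<Rightarrow> 's \<Rightarrow> real" where
  "step n f x = (\<Sum>y\<in>S. P n x y * f y)"

text \<open>\<open>steps n f\<close> is the mean of \<open>f\<close> at time n as a function of the
  state at time 0; the latest transition acts first on \<open>f\<close>, hence innermost.\<close>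

primrec steps :: "nat \<Rightarrow> ('s \<Rightarrow> real) \<Rightarrow> 's \<Rightarrow> real" where
  "steps 0 f = f"
| "steps (Suc n) f = steps n (step n f)"

lemma markov_operator_step: "markov_operator S (step n)"
  unfolding markov_operator_def
  by (auto simp: step_def distrib_left sum.distrib sum_distrib_left mult_ac P_sum P_nonneg
      intro!: sum_nonneg mult_nonneg_nonneg)

lemma markov_operator_steps: "markov_operator S (steps n)"
proof (induction n)
  case 0
  have "steps 0 = (\<lambda>f. f)" by (simp add: fun_eq_iff)
  then show ?case by (simp only: markov_operator_id)
next
  case (Suc n)
  have "steps (Suc n) = (\<lambda>f. steps n (step n f))" by (simp add: fun_eq_iff)
  then show ?case
    using markov_operator_comp[OF Suc markov_operator_step] by (simp only:)
qed

lemma step_mod: "step (n mod d) = step n"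
  by (simp add: step_def[abs_def] P_mod)

lemma steps_add_period: "steps (d + n) f = steps d (steps n f)"
proof (induction n arbitrary: f)
  case (Suc n)
  have "step (d + n) = step n"
    using step_mod[of "d + n"] step_mod[of n] by simp
  then show ?case by (simp add: Suc)
qed simp

lemma steps_mult_period: "steps (m * d) f = (steps d ^^ m) f"
  by (induction m) (simp_all add: steps_add_period)

context
  fixes w :: "'s \<Rightarrow> 's \<Rightarrow> real"
  assumes poisson: "\<And>f. \<exists>c h. \<forall>x\<in>S. f x - c = h x - steps d h x"
begin

definition gain :: "nat \<Rightarrow> 's \<Rightarrow> real" where
  "gain n x = (\<Sum>y\<in>S. P n x y * w x y)"

definition mean_gain :: real where
  "mean_gain = stationary_mean S (steps d) (\<lambda>x. \<Sum>k<d. steps k (gain k) x) / d"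

text \<open>Backward induction within a period, started from a Poisson solution \<open>h\<close> at
  its end. The Poisson equation says that a whole period turns \<open>h\<close> into
  \<open>h + c\<close>, which is what allows consecutive periods to be glued.\<close>

lemma martingale_corrector:
  obtains H :: "nat \<Rightarrow> 's \<Rightarrow> real" and B where
    "\<And>n x. x \<in> S \<Longrightarrow> H n x = (\<Sum>z\<in>S. P n x z * (w x z + H (Suc n) z))"
    "\<And>n x. x \<in> S \<Longrightarrow> \<bar>H n x + n * mean_gain\<bar> \<le> B"
proof -
  define c where "c = d * mean_gain"
  have c: "c = stationary_mean S (steps d) (\<lambda>x. \<Sum>k<d. steps k (gain k) x)"
    using d_pos by (simp add: c_def mean_gain_def)
  obtain h where h: "\<And>x. x \<in> S \<Longrightarrow> (\<Sum>k<d. steps k (gain k) x) - c = h x - steps d h x"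
    unfolding c
    by (rule stationary_mean_poisson[OF finite_S S_ne markov_operator_steps poisson,
          where f = "\<lambda>x. \<Sum>k<d. steps k (gain k) x"]) blast
  \<comment> \<open>\<open>v j\<close> is the expected payoff of the last j turns of a period plus
    \<open>h\<close> at its end.\<close>
  define v where "v = rec_nat h (\<lambda>j u x. gain (d - Suc j) x + step (d - Suc j) u x)"
  have v_0: "v 0 = h" and v_Suc: "v (Suc j) x = gain (d - Suc j) x + step (d - Suc j) (v j) x" for j x
    by (simp_all add: v_def)
  have v_d: "v d x = h x + c" if x: "x \<in> S" for x
  proof -
    have "k \<le> d \<Longrightarrow> v d x = (\<Sum>i<k. steps i (gain i) x) + steps k (v (d - k)) x" for k
    proof (induction k)
      case (Suc k)
      have "d - k = Suc (d - Suc k)" "d - Suc (d - Suc k) = k"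
        using Suc.prems by auto
      then have "v (d - k) = (\<lambda>x. gain k x + step k (v (d - Suc k)) x)"
        using v_Suc[of "d - Suc k"] by auto
      then show ?case
        using Suc by (simp add: markov_add[OF markov_operator_steps x])
    qed simp
    from this[of d] show ?thesis
      using h[OF x] by (simp add: v_0)
  qed
  \<comment> \<open>\<open>d - n mod d\<close> turns of the current period remain, and every
    completed period subtracts its mean gain \<open>c\<close>.\<close>
  define H where "H n x = v (d - n mod d) x - (n div d) * c" for n x
  have eq: "H n x = (\<Sum>z\<in>S. P n x z * (w x z + H (Suc n) z))" if x: "x \<in> S" for n x
  proof -
    define m where "m = n mod d"
    have "m < d" using d_pos by (simp add: m_def)
    have next_H: "H (Suc n) z = v (d - Suc m) z - (n div d) * c" if z: "z \<in> S" for z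
    proof (cases "Suc m = d")
      \<comment> \<open>At a period boundary \<open>v d = h + c\<close> compensates the additional
        subtraction of \<open>c\<close>.\<close>
      case True
      then have "Suc n mod d = 0" "Suc n div d = Suc (n div d)"
        by (auto simp: m_def mod_Suc div_Suc)
      then show ?thesis
        using True z by (simp add: H_def v_d v_0 algebra_simps)
    next
      case False
      then have "Suc n mod d = Suc m" "Suc n div d = n div d"
        by (auto simp: m_def mod_Suc div_Suc)
      then show ?thesis
        by (simp add: H_def)
    qed
    have "d - m = Suc (d - Suc m)" "d - Suc (d - Suc m) = m"
      using \<open>m < d\<close> by auto
    then have "H n x = gain m x + step m (v (d - Suc m)) x - (n div d) * c"
      using v_Suc[of "d - Suc m" x] by (simp add: H_def m_def)
    also have "\<dots> = gain n x + step n (v (d - Suc m)) x - (n div d) * c * (\<Sum>z\<in>S. P n x z)"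
      using P_mod[of n] by (simp add: m_def gain_def step_mod P_sum[OF x])
    also have "\<dots> = (\<Sum>z\<in>S. P n x z * (w x z + (v (d - Suc m) z - (n div d) * c)))"
      by (simp add: gain_def step_def sum_distrib_left sum.distrib sum_subtractf distrib_left
          right_diff_distrib mult_ac)
    also have "\<dots> = (\<Sum>z\<in>S. P n x z * (w x z + H (Suc n) z))"
      by (intro sum.cong) (simp_all add: next_H)
    finally show ?thesis .
  qed
  have bound: "\<bar>H n x + n * mean_gain\<bar> \<le> (\<Sum>j\<le>d. \<Sum>x\<in>S. \<bar>v j x\<bar>) + d * \<bar>mean_gain\<bar>"
    if x: "x \<in> S" for n x
  proof -
    have "real n = real (n div d * d + n mod d)" by simp
    then have n: "real n = real (n div d) * d + real (n mod d)"
      by (metis of_nat_add of_nat_mult)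
    have "H n x + n * mean_gain = v (d - n mod d) x + (n mod d) * mean_gain"
      unfolding H_def c_def n by (simp add: algebra_simps)
    also have "\<bar>\<dots>\<bar> \<le> \<bar>v (d - n mod d) x\<bar> + (n mod d) * \<bar>mean_gain\<bar>"
      by (metis abs_mult abs_of_nat abs_triangle_ineq)
    also have "\<bar>v (d - n mod d) x\<bar> \<le> (\<Sum>x\<in>S. \<bar>v (d - n mod d) x\<bar>)"
      using finite_S x by (intro member_le_sum) auto
    also have "\<dots> \<le> (\<Sum>j\<le>d. \<Sum>x\<in>S. \<bar>v j x\<bar>)"
      by (rule member_le_sum[where f = "\<lambda>j. \<Sum>x\<in>S. \<bar>v j x\<bar>"]) (auto intro: sum_nonneg)
    also have "(n mod d) * \<bar>mean_gain\<bar> \<le> d * \<bar>mean_gain\<bar>"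
      using d_pos by (intro mult_right_mono) (auto simp: less_imp_le)
    finally show ?thesis by simp
  qed
  show thesis by (rule that[OF eq bound])
qed

lemma periodic_chain_slln:
  assumes "markov_chain M S P Y"
  shows "AE \<omega> in M. (\<lambda>n. (\<Sum>k=1..n. w (Y (k - 1) \<omega>) (Y k \<omega>)) / n) \<longlonglongrightarrow> mean_gain"
proof -
  interpret finite_markov_chain M S P Y
    using assms finite_S P_nonneg P_sum by unfold_locales auto
  obtain H B where H: "\<And>n x. x \<in> S \<Longrightarrow> H n x = (\<Sum>z\<in>S. P n x z * (w x z + H (Suc n) z))"
    "\<And>n x. x \<in> S \<Longrightarrow> \<bar>H n x + n * mean_gain\<bar> \<le> B"
    using martingale_corrector by blast
  have "\<bar>w x z\<bar> \<le> (\<Sum>x\<in>S. \<Sum>z\<in>S. \<bar>w x z\<bar>)" if "x \<in> S" "z \<in> S" for x z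
  proof -
    have "\<bar>w x z\<bar> \<le> (\<Sum>z\<in>S. \<bar>w x z\<bar>)"
      using finite_S that by (intro member_le_sum) auto
    also have "\<dots> \<le> (\<Sum>x\<in>S. \<Sum>z\<in>S. \<bar>w x z\<bar>)"
      using finite_S that
      by (intro member_le_sum[where f = "\<lambda>x. \<Sum>z\<in>S. \<bar>w x z\<bar>"]) (auto intro: sum_nonneg)
    finally show ?thesis .
  qed
  then show ?thesis
    using H by (intro additive_functional_slln)
qed

text \<open>A property of all chains pins down \<mu> only if there is a chain;
  \<open>markov_chain_exists\<close> supplies one, and its almost sure limit is unique.\<close>

lemma almost_sure_mean_unique:
  assumes "\<And>(M :: (nat \<Rightarrow> 's) measure) Y. markov_chain M S P Y \<Longrightarrow>
      AE \<omega> in M. (\<lambda>n. (\<Sum>k=1..n. w (Y (k - 1) \<omega>) (Y k \<omega>)) / n) \<longlonglongrightarrow> \<mu>"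
  shows "\<mu> = mean_gain"
proof -
  obtain x where "x \<in> S" using S_ne by blast
  obtain M :: "(nat \<Rightarrow> 's) measure" and Y where chain: "markov_chain M S P Y"
    by (rule markov_chain_exists[where P = P, OF finite_S \<open>x \<in> S\<close>]) (blast intro: P_nonneg P_sum)+
  interpret prob_space M
    using chain by (simp add: markov_chain_def)
  have "AE \<omega> in M. \<mu> = mean_gain"
    using assms[OF chain] periodic_chain_slln[OF chain]
    by eventually_elim (rule LIMSEQ_unique)
  then show ?thesis by simp
qed

end

end

section \<open>The game\<close>

text \<open>The probability that player \<open>i\<close>, when he plays, changes his status: the
  circular counterpart of \<open>flip_rate\<close>.\<close>

definition circ_rate :: "nat \<Rightarrow> (nat \<Rightarrow> real) \<Rightarrow> (nat \<Rightarrow> bool) \<Rightarrow> nat \<Rightarrow> real" where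
  "circ_rate N p x i = (let m = circ_index N x i in if x i then 1 - p m else p m)"

lemma nbr_index_le: "nbr_index a b \<le> 3"
  by (simp add: nbr_index_def of_bool_def)

lemma circ_index_le: "circ_index N x i \<le> 3"
  by (simp add: circ_index_def nbr_index_le)

lemma game_matrix_circ_rate:
  "game_matrix N p (x, i) (y, j) =
    (if y = flip i x then circ_rate N p x i / N else if y = x then (1 - circ_rate N p x i) / N else 0)"
  by (auto simp: game_matrix_def circ_rate_def Let_def)

lemma flip_neq: "flip i x \<noteq> x"
  by (auto simp: flip_def fun_eq_iff)

lemma finite_game_states: "finite (game_states N)"
  unfolding game_states_def by (intro finite_cartesian_product finite_PiE) auto

lemma game_states_update:
  assumes "(x, i) \<in> game_states N" "j \<in> {1..N}"
  shows "(x(i := b), j) \<in> game_states N"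
  using assms by (auto simp: game_states_def PiE_def extensional_def)

lemma sum_two_points:
  fixes f g :: "'a \<Rightarrow> real"
  assumes "finite X" "a \<in> X" "b \<in> X" "a \<noteq> b"
  shows "(\<Sum>y\<in>X. if y = a then f y else if y = b then g y else 0) = f a + g b"
proof -
  have "(\<Sum>y\<in>X. if y = a then f y else if y = b then g y else 0) =
      (\<Sum>y\<in>X. (if y = a then f y else 0) + (if y = b then g y else 0))"
    using assms by (intro sum.cong) auto
  then show ?thesis
    using assms by (simp add: sum.distrib)
qed

lemma sum_game_matrix:
  assumes z: "(x, i) \<in> game_states N"
  shows "(\<Sum>z\<in>game_states N. game_matrix N p (x, i) z * u z) =
    (\<Sum>j=1..N. circ_rate N p x i * u (flip i x, j) + (1 - circ_rate N p x i) * u (x, j)) / N"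
proof -
  let ?X = "{1..N} \<rightarrow>\<^sub>E (UNIV :: bool set)" and ?c = "circ_rate N p x i"
  have "finite ?X" by (intro finite_PiE) auto
  have x: "x \<in> ?X" "flip i x \<in> ?X"
    using z by (auto simp: game_states_def flip_def PiE_def extensional_def)
  have "(\<Sum>z\<in>game_states N. game_matrix N p (x, i) z * u z) =
      (\<Sum>j=1..N. \<Sum>y\<in>?X. game_matrix N p (x, i) (y, j) * u (y, j))"
    unfolding game_states_def by (subst sum.swap) (simp add: sum.cartesian_product)
  also have "\<dots> = (\<Sum>j=1..N. \<Sum>y\<in>?X. if y = flip i x then ?c / N * u (y, j)
      else if y = x then (1 - ?c) / N * u (y, j) else 0)"
    by (intro sum.cong) (auto simp: game_matrix_circ_rate)
  also have "\<dots> = (\<Sum>j=1..N. ?c / N * u (flip i x, j) + (1 - ?c) / N * u (x, j))"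
    using sum_two_points[OF \<open>finite ?X\<close> x(2) x(1) flip_neq] by (intro sum.cong) auto
  finally show ?thesis
    by (simp add: sum_divide_distrib add_divide_distrib)
qed

text \<open>Game A is treated as game B with all parameters 1/2, so that every turn has one form
  with time-dependent parameters.\<close>

definition pattern_prob :: "nat \<Rightarrow> nat \<Rightarrow> (nat \<Rightarrow> real) \<Rightarrow> nat \<Rightarrow> nat \<Rightarrow> real" where
  "pattern_prob r s p n = (if n mod (r + s) < r then (\<lambda>_. 1/2) else p)"

lemma pattern_matrix_eq: "pattern_matrix N r s p n = game_matrix N (pattern_prob r s p n)"
  by (simp add: pattern_matrix_def pattern_prob_def)

locale pattern_game =
  fixes N r s :: nat and p :: "nat \<Rightarrow> real"
  assumes N: "1 \<le> N" and r: "1 \<le> r" and s: "1 \<le> s"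
    and p: "m \<le> 3 \<Longrightarrow> p m \<in> {0..1}"
begin

abbreviation "\<Sigma> \<equiv> game_states N"

abbreviation rate :: "nat \<Rightarrow> (nat \<Rightarrow> bool) \<Rightarrow> nat \<Rightarrow> real" where
  "rate n \<equiv> circ_rate N (pattern_prob r s p n)"

lemma pattern_prob_01: "m \<le> 3 \<Longrightarrow> pattern_prob r s p n m \<in> {0..1}"
  using p[of m] by (auto simp: pattern_prob_def)

lemma rate_01: "0 \<le> rate n x i" "rate n x i \<le> 1"
  using pattern_prob_01[OF circ_index_le, of n N x i] by (auto simp: circ_rate_def Let_def)

sublocale periodic_chain \<Sigma> "pattern_matrix N r s p" "r + s"
proof
  show "finite \<Sigma>" by (rule finite_game_states)
  have "(\<lambda>k\<in>{1..N}. True, 1) \<in> \<Sigma>"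
    using N by (auto simp: game_states_def)
  then show "\<Sigma> \<noteq> {}" by blast
  show "0 \<le> pattern_matrix N r s p n z z'" for n z z'
    using rate_01 by (cases z; cases z') (simp add: pattern_matrix_eq game_matrix_circ_rate)
  show "(\<Sum>z'\<in>\<Sigma>. pattern_matrix N r s p n z z') = 1" if "z \<in> \<Sigma>" for n z
    using that N sum_game_matrix[where u = "\<lambda>_. 1", of "fst z" "snd z"]
    by (simp add: pattern_matrix_eq)
  show "0 < r + s" using r by simp
  show "pattern_matrix N r s p (n mod (r + s)) = pattern_matrix N r s p n" for n
    by (simp add: pattern_matrix_def fun_eq_iff)
qed

section \<open>Doeblin minorization for the game\<close>

lemma step_eq:
  assumes "(x, i) \<in> \<Sigma>"
  shows "step n f (x, i) = (\<Sum>j=1..N. rate n x i * f (flip i x, j) + (1 - rate n x i) * f (x, j)) / N"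
  unfolding step_def pattern_matrix_eq by (rule sum_game_matrix[OF assms])

text \<open>The constant is 1/2 for the outcome \<open>b\<close> times 1/N for the choice of the
  next player \<open>j\<close>.\<close>

lemma step_ge:
  assumes z: "(x, i) \<in> \<Sigma>" and j: "j \<in> {1..N}" and f: "\<And>z. z \<in> \<Sigma> \<Longrightarrow> 0 \<le> f z"
    and b: "1/2 \<le> (if b = x i then 1 - rate n x i else rate n x i)"
  shows "1 / (2 * N) * f (x(i := b), j) \<le> step n f (x, i)"
proof -
  let ?g = "\<lambda>j. rate n x i * f (flip i x, j) + (1 - rate n x i) * f (x, j)"
  have f': "0 \<le> f (flip i x, k)" "0 \<le> f (x, k)" if "k \<in> {1..N}" for k
    using game_states_update[OF z that, of "\<not> x i"] game_states_update[OF z that, of "x i"] f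
    by (auto simp: flip_def)
  have nonneg: "0 \<le> ?g k" if "k \<in> {1..N}" for k
    using f'[OF that] rate_01 by (intro add_nonneg_nonneg mult_nonneg_nonneg) auto
  have "1/2 * f (x(i := b), j) \<le> ?g j"
  proof (cases "b = x i")
    case True
    then have "1/2 * f (x(i := b), j) \<le> (1 - rate n x i) * f (x, j)"
      using b f'[OF j] by (intro mult_mono) auto
    moreover have "0 \<le> rate n x i * f (flip i x, j)"
      using f'[OF j] rate_01 by (intro mult_nonneg_nonneg) auto
    ultimately show ?thesis by linarith
  next
    case False
    then have "x(i := b) = flip i x" by (auto simp: flip_def)
    then have "1/2 * f (x(i := b), j) \<le> rate n x i * f (flip i x, j)"
      using b f'[OF j] False by (intro mult_mono) auto
    moreover have "0 \<le> (1 - rate n x i) * f (x, j)"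
      using f'[OF j] rate_01 by (intro mult_nonneg_nonneg) auto
    ultimately show ?thesis by linarith
  qed
  also have "?g j \<le> (\<Sum>k=1..N. ?g k)"
    using nonneg j by (intro member_le_sum) auto
  finally have "1/2 * f (x(i := b), j) / N \<le> (\<Sum>k=1..N. ?g k) / N"
    by (intro divide_right_mono) auto
  then show ?thesis
    by (simp add: step_eq[OF z] field_simps)
qed

text \<open>Says that the n-step transition probability from \<open>z\<close> to \<open>z'\<close>
  is at least \<open>(1 / (2 * N)) ^ n\<close>, in the test-function form that
  \<open>poisson_equation\<close> takes.\<close>

definition reach :: "nat \<Rightarrow> game_state \<Rightarrow> game_state \<Rightarrow> bool" where
  "reach n z z' \<longleftrightarrow> z' \<in> \<Sigma> \<and>
     (\<forall>f. (\<forall>y\<in>\<Sigma>. 0 \<le> f y) \<longrightarrow> (1 / (2 * N)) ^ n * f z' \<le> steps n f z)"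

lemma reach_0: "z \<in> \<Sigma> \<Longrightarrow> reach 0 z z"
  by (simp add: reach_def)

lemma reach_Suc:
  assumes z': "reach n z (x, i)" and j: "j \<in> {1..N}"
    and b: "1/2 \<le> (if b = x i then 1 - rate n x i else rate n x i)"
  shows "reach (Suc n) z (x(i := b), j)"
  unfolding reach_def
proof (intro conjI allI impI)
  have xi: "(x, i) \<in> \<Sigma>"
    using z' by (simp add: reach_def)
  then show "(x(i := b), j) \<in> \<Sigma>"
    using j by (rule game_states_update)
  fix f :: "game_state \<Rightarrow> real" assume f: "\<forall>y\<in>\<Sigma>. 0 \<le> f y"
  have "(1 / (2 * N)) ^ Suc n * f (x(i := b), j) = (1 / (2 * N)) ^ n * (1 / (2 * N) * f (x(i := b), j))"
    by simp
  also have "\<dots> \<le> (1 / (2 * N)) ^ n * step n f (x, i)"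
    using f b by (intro mult_left_mono step_ge[OF xi j]) auto
  also have "\<dots> \<le> steps n (step n f) z"
    using z' f markov_nonneg[OF markov_operator_step] by (auto simp: reach_def)
  finally show "(1 / (2 * N)) ^ Suc n * f (x(i := b), j) \<le> steps (Suc n) f z"
    by simp
qed

text \<open>Flipping or staying has probability at least 1/2. The outcome \<open>b\<close> is chosen
  before \<open>z\<close>, so trajectories that have met can be continued together whatever their
  starts.\<close>

lemma reach_some:
  "\<exists>b. \<forall>z. reach n z (x, i) \<longrightarrow> (\<forall>j\<in>{1..N}. reach (Suc n) z (x(i := b), j))"
proof (cases "1/2 \<le> rate n x i")
  case True
  show ?thesis
    by (intro exI[of _ "\<not> x i"] allI impI ballI, rule reach_Suc) (use True in auto)
next
  case False
  show ?thesis
    by (intro exI[of _ "x i"] allI impI ballI, rule reach_Suc) (use False in auto)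
qed

text \<open>Multiples of \<open>r + s\<close> open a period, where the fair game A makes either
  outcome available.\<close>

lemma reach_A:
  assumes "reach n z (x, i)" "j \<in> {1..N}" "(r + s) dvd n"
  shows "reach (Suc n) z (x(i := b), j)"
  using assms r by (intro reach_Suc) (auto simp: circ_rate_def Let_def pattern_prob_def)

text \<open>Player \<open>q < N\<close> plays game A at time \<open>q (r + s)\<close> and wins; at all times that are not multiples of
  \<open>r + s\<close>, player \<open>N\<close> plays, whatever the outcome. At time \<open>N (r + s)\<close> player \<open>N\<close> plays game A and
  wins, whereupon everybody is a winner.\<close>

definition scheduled :: "nat \<Rightarrow> nat" where
  "scheduled n = (if (r + s) dvd n then n div (r + s) else N)"

lemma scheduled_in: "1 \<le> n \<Longrightarrow> n \<le> N * (r + s) \<Longrightarrow> scheduled n \<in> {1..N}"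
  using N r by (auto simp: scheduled_def elim!: dvdE)

text \<open>The invariant is that players already served by a game A are winners. Player
  \<open>N\<close> is left out, since his status is uncontrolled while he absorbs the turns in
  between.\<close>

lemma reach_schedule:
  assumes z: "z \<in> \<Sigma>"
  shows "1 \<le> n \<Longrightarrow> n \<le> N * (r + s) \<Longrightarrow>
    \<exists>x. reach n z (x, scheduled n) \<and> (\<forall>l\<in>{1..<N}. l * (r + s) < n \<longrightarrow> x l)"
proof (induction n rule: dec_induct)
  \<comment> \<open>The start state dictates who plays at time 0, so the schedule takes over at time
    1.\<close>
  case base
  obtain x i where xi: "z = (x, i)" by fastforce
  obtain b where "\<forall>z. reach 0 z (x, i) \<longrightarrow> (\<forall>j\<in>{1..N}. reach (Suc 0) z (x(i := b), j))"
    using reach_some by blast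
  then have "reach 1 z (x(i := b), scheduled 1)"
    using reach_0[OF z] xi scheduled_in[of 1] base by simp
  moreover have "\<not> l * (r + s) < 1" if "l \<in> {1..<N}" for l
    using that r by simp
  ultimately show ?case by blast
next
  case (step n)
  then obtain x where x: "reach n z (x, scheduled n)" "\<forall>l\<in>{1..<N}. l * (r + s) < n \<longrightarrow> x l"
    by auto
  have j: "scheduled (Suc n) \<in> {1..N}"
    using step by (intro scheduled_in) auto
  show ?case
  proof (cases "(r + s) dvd n")
    case True
    have "(x(scheduled n := True)) l" if "l \<in> {1..<N}" "l * (r + s) < Suc n" for l
      using x(2) that True r by (cases "l * (r + s) = n") (auto simp: scheduled_def)
    then show ?thesis
      using reach_A[OF x(1) j True, of True] by blast
  next
    case False
    obtain b where b: "reach (Suc n) z (x(scheduled n := b), scheduled (Suc n))"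
      using reach_some[of n x "scheduled n"] x(1) j by blast
    have "(x(scheduled n := b)) l" if "l \<in> {1..<N}" "l * (r + s) < Suc n" for l
    proof -
      have "l * (r + s) \<noteq> n" using False by auto
      then show ?thesis
        using x(2) that False by (auto simp: scheduled_def)
    qed
    then show ?thesis
      using b by blast
  qed
qed

lemma reach_all_winners:
  assumes z: "z \<in> \<Sigma>"
  shows "reach (Suc (N * (r + s))) z (\<lambda>l\<in>{1..N}. True, 1)"
proof -
  have "1 \<le> N * (r + s)"
    using N r by simp
  then obtain x where x: "reach (N * (r + s)) z (x, scheduled (N * (r + s)))"
    "\<forall>l\<in>{1..<N}. l * (r + s) < N * (r + s) \<longrightarrow> x l"
    using reach_schedule[OF z, of "N * (r + s)"] by auto
  have N': "scheduled (N * (r + s)) = N"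
    using r by (simp add: scheduled_def)
  have "reach (Suc (N * (r + s))) z (x(N := True), 1)"
    using reach_A[OF x(1), of 1 True] N N' by simp
  moreover have "x(N := True) = (\<lambda>l\<in>{1..N}. True)"
  proof
    fix l
    have "(x, N) \<in> \<Sigma>"
      using x(1) N' by (simp add: reach_def)
    then show "(x(N := True)) l = (\<lambda>l\<in>{1..N}. True) l"
      using x(2) N r by (auto simp: game_states_def PiE_def extensional_def)
  qed
  ultimately show ?thesis by simp
qed

text \<open>Once all starts have met in one state, \<open>reach_some\<close> moves them on together;
  this extends the meeting time to any later horizon.\<close>

lemma reach_common:
  assumes "n \<ge> Suc (N * (r + s))"
  shows "\<exists>y\<in>\<Sigma>. \<forall>z\<in>\<Sigma>. reach n z y"
  using assms
proof (induction n rule: dec_induct)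
  case base
  have "(\<lambda>l\<in>{1..N}. True, 1) \<in> \<Sigma>"
    using N by (auto simp: game_states_def)
  then show ?case
    using reach_all_winners by blast
next
  case (step n)
  then obtain x i where xi: "(x, i) \<in> \<Sigma>" "\<And>z. z \<in> \<Sigma> \<Longrightarrow> reach n z (x, i)"
    by auto
  obtain b where b: "\<forall>z. reach n z (x, i) \<longrightarrow> (\<forall>j\<in>{1..N}. reach (Suc n) z (x(i := b), j))"
    using reach_some by blast
  have "(x(i := b), 1) \<in> \<Sigma>"
    using xi(1) N by (intro game_states_update) auto
  then show ?case
    using xi(2) b N by (intro bexI[of _ "(x(i := b), 1)"]) auto
qed

lemma game_poisson: "\<exists>c h. \<forall>z\<in>\<Sigma>. f z - c = h z - steps (r + s) h z"
proof -
  \<comment> \<open>The minorization must concern a power of the one-period operator, so the horizon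
    is padded to N + 1 full periods.\<close>
  have "Suc (N * (r + s)) \<le> Suc N * (r + s)"
    using r by simp
  then obtain y where y: "y \<in> \<Sigma>" "\<And>z. z \<in> \<Sigma> \<Longrightarrow> reach (Suc N * (r + s)) z y"
    using reach_common by blast
  show ?thesis
  proof (rule poisson_equation[OF finite_S markov_operator_steps y(1)])
    show "0 < (1 / (2 * N)) ^ (Suc N * (r + s))"
      using N by simp
    show "(1 / (2 * N)) ^ (Suc N * (r + s)) * g y \<le> (steps (r + s) ^^ Suc N) g z"
      if "\<And>z. z \<in> \<Sigma> \<Longrightarrow> 0 \<le> g z" "z \<in> \<Sigma>" for g z
      using y(2)[OF that(2)] that(1) unfolding reach_def steps_mult_period by auto
  qed
qed

lemma mean_profit_eq: "mean_profit N r s p = mean_gain payoff"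
  unfolding mean_profit_def
proof (rule the_equality)
  show "is_mean_profit N r s p (mean_gain payoff)"
    unfolding is_mean_profit_def using periodic_chain_slln[OF game_poisson] by blast
  show "\<mu> = mean_gain payoff" if "is_mean_profit N r s p \<mu>" for \<mu>
    using that unfolding is_mean_profit_def
    by (intro almost_sure_mean_unique[OF game_poisson]) blast
qed

end

section \<open>Rotation averages\<close>

text \<open>The player \<open>i + k\<close> counted around the circle; the shifts by one translate
  between players 1, ..., N and residues 0, ..., N - 1.\<close>

definition site :: "nat \<Rightarrow> nat \<Rightarrow> int \<Rightarrow> nat" where
  "site N i k = Suc (nat ((int i + k - 1) mod int N))"

definition unroll :: "nat \<Rightarrow> nat \<Rightarrow> (nat \<Rightarrow> bool) \<Rightarrow> int \<Rightarrow> bool" where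
  "unroll N i x k = x (site N i k)"

definition rotation_mean :: "nat \<Rightarrow> ((int \<Rightarrow> bool) \<Rightarrow> real) \<Rightarrow> (nat \<Rightarrow> bool) \<Rightarrow> real" where
  "rotation_mean N f x = (\<Sum>i=1..N. f (unroll N i x)) / N"

lemma site_in: "1 \<le> N \<Longrightarrow> site N i k \<in> {1..N}"
  using pos_mod_bound[of "int N" "int i + k - 1"] pos_mod_sign[of "int N" "int i + k - 1"]
  unfolding site_def by (subst atLeastAtMost_iff) (simp only: Suc_le_eq nat_less_iff, simp)

lemma site_0: "i \<in> {1..N} \<Longrightarrow> site N i 0 = i"
  by (auto simp: site_def mod_pos_pos_trivial)

lemma site_minus_1: "1 \<le> N \<Longrightarrow> site N i (k - 1) = (if site N i k = 1 then N else site N i k - 1)"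
proof -
  assume N: "1 \<le> N"
  define a where "a = (int i + k - 1) mod int N"
  have a: "0 \<le> a" "a < int N" using N by (auto simp: a_def)
  have "(int i + (k - 1) - 1) mod int N = (a - 1) mod int N"
    unfolding a_def by (simp add: mod_diff_left_eq algebra_simps)
  also have "\<dots> = (if a = 0 then int N - 1 else a - 1)"
  proof (cases "a = 0")
    case True
    then show ?thesis
      using N zmod_minus1[of "int N"] by simp
  qed (use a in \<open>simp add: mod_pos_pos_trivial\<close>)
  finally show ?thesis
    using a N by (auto simp: site_def a_def[symmetric] nat_diff_distrib)
qed

lemma site_plus_1: "1 \<le> N \<Longrightarrow> site N i (k + 1) = (if site N i k = N then 1 else site N i k + 1)"
proof -
  assume N: "1 \<le> N"
  define a where "a = (int i + k - 1) mod int N"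
  have a: "0 \<le> a" "a < int N" using N by (auto simp: a_def)
  have "(int i + (k + 1) - 1) mod int N = (a + 1) mod int N"
    using mod_add_left_eq[of "int i + k - 1" "int N" 1] by (simp add: a_def algebra_simps)
  also have "\<dots> = (if a = int N - 1 then 0 else a + 1)"
    using a by (auto simp: mod_pos_pos_trivial)
  finally show ?thesis
    using a N by (auto simp: site_def a_def[symmetric] nat_add_distrib)
qed

lemma circ_index_site:
  assumes "1 \<le> N"
  shows "circ_index N x (site N i k) = nbr_index (unroll N i x (k - 1)) (unroll N i x (k + 1))"
  using assms by (simp add: circ_index_def unroll_def site_minus_1 site_plus_1)

lemma circ_rate_site:
  assumes "1 \<le> N"
  shows "circ_rate N p x (site N i k) = flip_rate p k (unroll N i x)"
  by (simp add: circ_rate_def flip_rate_def circ_index_site[OF assms] unroll_def)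

text \<open>A window shorter than the circumference does not overlap itself, wherever it is
  placed.\<close>

lemma inj_on_site:
  assumes "finite A"
  shows "\<forall>\<^sub>F N in sequentially. \<forall>i. inj_on (site N i) A"
proof -
  define b where "b = Max (insert 1 (abs ` A))"
  have b: "\<bar>k\<bar> \<le> b" if "k \<in> A" for k
    using assms that by (auto simp: b_def)
  have "inj_on (site N i) A" if N: "nat (2 * b) < N" for N i
  proof (rule inj_onI)
    fix k k' assume k: "k \<in> A" "k' \<in> A" "site N i k = site N i k'"
    have "(int i + k - 1) mod int N = (int i + k' - 1) mod int N"
      using k(3) N by (simp add: site_def eq_nat_nat_iff)
    then have "int N dvd (k - k')"
      by (metis (no_types, lifting) mod_eq_dvd_iff add_diff_cancel_left diff_diff_eq2 diff_add_eq)
    moreover have "\<bar>k - k'\<bar> < int N"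
      using b[OF k(1)] b[OF k(2)] N by linarith
    ultimately show "k = k'"
      by (metis dvd_imp_le_int eq_iff_diff_eq_0 leD abs_of_nat)
  qed
  then show ?thesis
    by (intro eventually_mono[OF eventually_gt_at_top[of "nat (2 * b)"]]) blast
qed

text \<open>Flipping one player flips infinitely many sites of the periodic extension, but
  injectivity leaves at most one of them in the window \<open>A\<close>, and \<open>f\<close> sees
  nothing else.\<close>

lemma rotation_mean_generator:
  assumes "1 \<le> N" and "finite A" and A: "\<And>x y. (\<forall>k\<in>A. x k = y k) \<Longrightarrow> f x = f y"
    and inj: "\<And>i. inj_on (site N i) A"
  shows "(\<Sum>j=1..N. circ_rate N p x j * (rotation_mean N f (flip j x) - rotation_mean N f x)) =
    rotation_mean N (spin_gen p f) x"
proof -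
  have inner: "(\<Sum>j=1..N. circ_rate N p x j * (f (unroll N i (flip j x)) - f (unroll N i x))) =
      spin_gen p f (unroll N i x)" for i
  proof -
    have "(\<Sum>j=1..N. circ_rate N p x j * (f (unroll N i (flip j x)) - f (unroll N i x))) =
        (\<Sum>j\<in>site N i ` A. circ_rate N p x j * (f (unroll N i (flip j x)) - f (unroll N i x)))"
    proof (rule sum.mono_neutral_right)
      show "site N i ` A \<subseteq> {1..N}"
        using site_in[OF \<open>1 \<le> N\<close>] by blast
      have "f (unroll N i (flip j x)) = f (unroll N i x)" if "j \<notin> site N i ` A" for j
        using that by (intro A) (auto simp: unroll_def flip_def)
      then show "\<forall>j\<in>{1..N} - site N i ` A.
          circ_rate N p x j * (f (unroll N i (flip j x)) - f (unroll N i x)) = 0"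
        by auto
    qed simp
    also have "\<dots> = (\<Sum>k\<in>A. circ_rate N p x (site N i k) *
        (f (unroll N i (flip (site N i k) x)) - f (unroll N i x)))"
      by (simp add: sum.reindex[OF inj])
    also have "\<dots> = (\<Sum>k\<in>A. flip_rate p k (unroll N i x) * (f (flip k (unroll N i x)) - f (unroll N i x)))"
    proof (intro sum.cong refl)
      fix k assume k: "k \<in> A"
      have "f (unroll N i (flip (site N i k) x)) = f (flip k (unroll N i x))"
        using inj_onD[OF inj _ _ k, of i] by (intro A) (auto simp: unroll_def flip_def)
      then show "circ_rate N p x (site N i k) * (f (unroll N i (flip (site N i k) x)) - f (unroll N i x)) =
          flip_rate p k (unroll N i x) * (f (flip k (unroll N i x)) - f (unroll N i x))"
        by (simp add: circ_rate_site[OF \<open>1 \<le> N\<close>])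
    qed
    also have "\<dots> = spin_gen p f (unroll N i x)"
      using spin_gen_finite_sum[OF \<open>finite A\<close> A] by simp
    finally show ?thesis .
  qed
  have "(\<Sum>j=1..N. circ_rate N p x j * (rotation_mean N f (flip j x) - rotation_mean N f x)) =
      (\<Sum>j=1..N. \<Sum>i=1..N. circ_rate N p x j * (f (unroll N i (flip j x)) - f (unroll N i x)) / N)"
    by (simp add: rotation_mean_def sum_distrib_left right_diff_distrib diff_divide_distrib
        sum_divide_distrib sum_subtractf)
  also have "\<dots> = (\<Sum>i=1..N. \<Sum>j=1..N. circ_rate N p x j * (f (unroll N i (flip j x)) - f (unroll N i x)) / N)"
    by (rule sum.swap)
  also have "\<dots> = rotation_mean N (spin_gen p f) x"
    by (simp add: rotation_mean_def inner[unfolded One_nat_def] flip: sum_divide_distrib)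
  finally show ?thesis .
qed

lemma abs_rotation_mean_le:
  assumes "\<And>y. \<bar>f y\<bar> \<le> C" "1 \<le> N"
  shows "\<bar>rotation_mean N f x\<bar> \<le> C"
proof -
  have "\<bar>\<Sum>i=1..N. f (unroll N i x)\<bar> \<le> (\<Sum>i=1..N. C)"
    using assms(1) by (intro order_trans[OF sum_abs] sum_mono) auto
  then show ?thesis
    using assms(2) by (simp add: rotation_mean_def field_simps)
qed

section \<open>Stationary means at the phases of the period\<close>

context pattern_game
begin

definition game_mean :: "(game_state \<Rightarrow> real) \<Rightarrow> real" where
  "game_mean = stationary_mean \<Sigma> (steps (r + s))"

lemmas game_mean_facts = finite_S S_ne markov_operator_steps game_poisson

lemma game_mean_add: "game_mean (\<lambda>z. f z + g z) = game_mean f + game_mean g"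
  unfolding game_mean_def by (rule stationary_mean_add[OF game_mean_facts])

lemma game_mean_scale: "game_mean (\<lambda>z. c * f z) = c * game_mean f"
  unfolding game_mean_def by (rule stationary_mean_scale[OF game_mean_facts])

lemma game_mean_const: "game_mean (\<lambda>_. c) = c"
  unfolding game_mean_def by (rule stationary_mean_const[OF game_mean_facts])

lemma game_mean_ge: "(\<And>z. z \<in> \<Sigma> \<Longrightarrow> b \<le> f z) \<Longrightarrow> b \<le> game_mean f"
  unfolding game_mean_def by (rule stationary_mean_ge[OF game_mean_facts])

lemma game_mean_period: "game_mean (steps (r + s) f) = game_mean f"
  unfolding game_mean_def by (rule stationary_mean_invariant[OF game_mean_facts])

lemma game_mean_sum: "game_mean (\<lambda>z. \<Sum>a\<in>A. f a z) = (\<Sum>a\<in>A. game_mean (f a))"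
  by (induction A rule: infinite_finite_induct) (simp_all add: game_mean_const game_mean_add)

lemma game_mean_mono:
  assumes "\<And>z. z \<in> \<Sigma> \<Longrightarrow> f z \<le> g z"
  shows "game_mean f \<le> game_mean g"
proof -
  have "0 \<le> game_mean (\<lambda>z. g z + (- 1) * f z)"
    using assms by (intro game_mean_ge) simp
  also have "\<dots> = game_mean g + (- 1) * game_mean f"
    by (simp only: game_mean_add game_mean_scale)
  finally show ?thesis by simp
qed

lemma game_mean_cong: "(\<And>z. z \<in> \<Sigma> \<Longrightarrow> f z = g z) \<Longrightarrow> game_mean f = game_mean g"
  by (intro antisym game_mean_mono) auto

text \<open>\<open>phase_mean k\<close> is the stationary mean at the times congruent to \<open>k\<close> modulo \<open>r + s\<close>.\<close>

definition phase_mean :: "nat \<Rightarrow> (game_state \<Rightarrow> real) \<Rightarrow> real" where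
  "phase_mean k f = game_mean (steps k f)"

lemma phase_mean_add: "phase_mean k (\<lambda>z. f z + g z) = phase_mean k f + phase_mean k g"
  unfolding phase_mean_def
  by (simp add: markov_add[OF markov_operator_steps] game_mean_add[symmetric] cong: game_mean_cong)

lemma phase_mean_scale: "phase_mean k (\<lambda>z. c * f z) = c * phase_mean k f"
  unfolding phase_mean_def
  by (simp add: markov_scale[OF markov_operator_steps] game_mean_scale[symmetric] cong: game_mean_cong)

lemma phase_mean_const: "phase_mean k (\<lambda>_. c) = c"
  unfolding phase_mean_def
  by (simp add: markov_const[OF markov_operator_steps] game_mean_const cong: game_mean_cong)

lemma phase_mean_mono: "(\<And>z. z \<in> \<Sigma> \<Longrightarrow> f z \<le> g z) \<Longrightarrow> phase_mean k f \<le> phase_mean k g"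
  unfolding phase_mean_def by (intro game_mean_mono markov_mono[OF markov_operator_steps])

lemma phase_mean_cong: "(\<And>z. z \<in> \<Sigma> \<Longrightarrow> f z = g z) \<Longrightarrow> phase_mean k f = phase_mean k g"
  by (intro antisym phase_mean_mono) auto

lemma abs_phase_mean_le:
  assumes "\<And>z. z \<in> \<Sigma> \<Longrightarrow> \<bar>f z\<bar> \<le> C"
  shows "\<bar>phase_mean k f\<bar> \<le> C"
proof -
  have "phase_mean k f \<le> phase_mean k (\<lambda>_. C)" "phase_mean k (\<lambda>_. - C) \<le> phase_mean k f"
    using assms by (auto intro!: phase_mean_mono simp: abs_le_iff minus_le_iff)
  then show ?thesis
    by (simp add: phase_mean_const)
qed

lemma phase_mean_Suc: "phase_mean (Suc k) f = phase_mean k (step k f)"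
  by (simp add: phase_mean_def)

lemma phase_mean_period: "phase_mean (r + s) f = phase_mean 0 f"
  by (simp add: phase_mean_def game_mean_period)

text \<open>The next player is drawn uniformly whatever the outcome of the turn, so
  \<open>step k\<close> cannot tell \<open>f\<close> from its average over players.\<close>

lemma phase_mean_player_Suc:
  "phase_mean (Suc k) f = phase_mean (Suc k) (\<lambda>(x, i). (\<Sum>j=1..N. f (x, j)) / N)"
  unfolding phase_mean_Suc
proof (rule phase_mean_cong)
  fix z assume "z \<in> \<Sigma>"
  then show "step k f z = step k (\<lambda>(x, i). (\<Sum>j=1..N. f (x, j)) / N) z"
    using N by (cases z) (simp add: step_eq sum.distrib sum_distrib_left add_divide_distrib)
qed

text \<open>The player to move is uniformly distributed and independent of the status vector.\<close>

lemma phase_mean_player: "phase_mean k f = phase_mean k (\<lambda>(x, i). (\<Sum>j=1..N. f (x, j)) / N)"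
proof (cases k)
  case 0
  \<comment> \<open>Phase 0 agrees with phase \<open>r + s\<close>, which does come after a
    turn.\<close>
  have "Suc (r + s - 1) = r + s" using r by simp
  then have "phase_mean (r + s) f = phase_mean (r + s) (\<lambda>(x, i). (\<Sum>j=1..N. f (x, j)) / N)"
    using phase_mean_player_Suc[of "r + s - 1" f] by simp
  then show ?thesis
    using 0 by (simp add: phase_mean_period)
next
  case (Suc m)
  then show ?thesis
    using phase_mean_player_Suc by simp
qed

text \<open>A discrete Dynkin formula: averaging the flip of the player to move over all players
  yields 1/N times the generator on the circle.\<close>

lemma phase_mean_status_Suc:
  "phase_mean (Suc k) (\<lambda>z. \<phi> (fst z)) = phase_mean k (\<lambda>z. \<phi> (fst z)) +
    phase_mean k (\<lambda>z. \<Sum>j=1..N. rate k (fst z) j * (\<phi> (flip j (fst z)) - \<phi> (fst z))) / N"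
proof -
  have "phase_mean (Suc k) (\<lambda>z. \<phi> (fst z)) =
      phase_mean k (\<lambda>(x, i). \<phi> x + rate k x i * (\<phi> (flip i x) - \<phi> x))"
    unfolding phase_mean_Suc
  proof (rule phase_mean_cong)
    fix z assume "z \<in> \<Sigma>"
    then show "step k (\<lambda>z. \<phi> (fst z)) z = (\<lambda>(x, i). \<phi> x + rate k x i * (\<phi> (flip i x) - \<phi> x)) z"
      using N by (cases z) (simp add: step_eq, simp add: algebra_simps)
  qed
  also have "\<dots> = phase_mean k (\<lambda>z. \<phi> (fst z) +
      1 / N * (\<Sum>j=1..N. rate k (fst z) j * (\<phi> (flip j (fst z)) - \<phi> (fst z))))"
    by (subst phase_mean_player) (rule phase_mean_cong, use N in \<open>auto simp: sum.distrib add_divide_distrib\<close>)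
  also have "\<dots> = phase_mean k (\<lambda>z. \<phi> (fst z)) +
      1 / N * phase_mean k (\<lambda>z. \<Sum>j=1..N. rate k (fst z) j * (\<phi> (flip j (fst z)) - \<phi> (fst z)))"
    by (simp only: phase_mean_add phase_mean_scale)
  finally show ?thesis by simp
qed

text \<open>For \<open>k = 0\<close> this is the functional \<open>\<Lambda>\<^sub>N\<close> of the
  overview.\<close>

definition rotated_mean :: "nat \<Rightarrow> ((int \<Rightarrow> bool) \<Rightarrow> real) \<Rightarrow> real" where
  "rotated_mean k f = phase_mean k (\<lambda>z. rotation_mean N f (fst z))"

lemma mean_functional_rotated_mean: "mean_functional (rotated_mean k)"
  unfolding mean_functional_def
proof (intro conjI allI impI)
  fix f g :: "(int \<Rightarrow> bool) \<Rightarrow> real" and c :: real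
  have "rotation_mean N (\<lambda>x. f x + g x) y = rotation_mean N f y + rotation_mean N g y" for y
    by (simp add: rotation_mean_def sum.distrib add_divide_distrib)
  then show "rotated_mean k (\<lambda>x. f x + g x) = rotated_mean k f + rotated_mean k g"
    by (simp add: rotated_mean_def phase_mean_add)
  have "rotation_mean N (\<lambda>x. c * f x) y = c * rotation_mean N f y" for y
    by (simp add: rotation_mean_def sum_distrib_left)
  then show "rotated_mean k (\<lambda>x. c * f x) = c * rotated_mean k f"
    by (simp add: rotated_mean_def phase_mean_scale)
  have "rotation_mean N (\<lambda>_. 1) y = 1" for y
    using N by (simp add: rotation_mean_def)
  then show "rotated_mean k (\<lambda>_. 1) = 1"
    by (simp add: rotated_mean_def phase_mean_const)
  assume "\<forall>x. 0 \<le> f x"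
  then have "phase_mean k (\<lambda>_. 0) \<le> rotated_mean k f"
    unfolding rotated_mean_def
    by (intro phase_mean_mono) (auto simp: rotation_mean_def intro!: divide_nonneg_nonneg sum_nonneg)
  then show "0 \<le> rotated_mean k f"
    by (simp add: phase_mean_const)
qed

lemma abs_rotated_mean_le: "(\<And>y. \<bar>f y\<bar> \<le> C) \<Longrightarrow> \<bar>rotated_mean k f\<bar> \<le> C"
  unfolding rotated_mean_def using N by (intro abs_phase_mean_le abs_rotation_mean_le)

lemma rotated_mean_period: "rotated_mean (r + s) f = rotated_mean 0 f"
  by (simp add: rotated_mean_def phase_mean_period)

lemma rotated_mean_Suc:
  assumes "finite A" and A: "\<And>x y. (\<forall>k\<in>A. x k = y k) \<Longrightarrow> f x = f y"
    and inj: "\<And>i. inj_on (site N i) A"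
  shows "rotated_mean (Suc k) f = rotated_mean k f + rotated_mean k (spin_gen (pattern_prob r s p k) f) / N"
proof -
  have "(\<Sum>j=1..N. rate k x j * (rotation_mean N f (flip j x) - rotation_mean N f x)) =
      rotation_mean N (spin_gen (pattern_prob r s p k) f) x" for x
    by (rule rotation_mean_generator[OF N \<open>finite A\<close> A inj])
  then show ?thesis
    by (simp only: rotated_mean_def phase_mean_status_Suc)
qed

text \<open>Winning has probability \<open>p m\<close> whether the player was a winner or a loser,
  so the expected payoff is \<open>2 * p m - 1\<close>; averaging over the uniform player and
  centring at him puts his neighbours at -1 and 1.\<close>

lemma mean_profit_rotated_mean:
  "(r + s) * mean_profit N r s p =
    (\<Sum>k<r+s. rotated_mean k (\<lambda>y. 2 * pattern_prob r s p k (nbr_index (y (- 1)) (y 1)) - 1))"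
proof -
  have gain: "gain payoff k (x, i) = 2 * pattern_prob r s p k (circ_index N x i) - 1"
    if "(x, i) \<in> \<Sigma>" for k x i
  proof -
    have "gain payoff k (x, i) = (\<Sum>j=1..N. rate k x i * (if x i then - 1 else 1) +
        (1 - rate k x i) * (if x i then 1 else - 1)) / N"
      unfolding gain_def[OF game_poisson] pattern_matrix_eq sum_game_matrix[OF that]
      using flip_neq[of i x] by (auto simp: payoff_def)
    then show ?thesis
      using N by (simp add: circ_rate_def Let_def)
  qed
  have "(r + s) * mean_profit N r s p = game_mean (\<lambda>z. \<Sum>k<r+s. steps k (gain payoff k) z)"
    using r by (simp add: mean_profit_eq mean_gain_def[OF game_poisson] game_mean_def)
  also have "\<dots> = (\<Sum>k<r+s. phase_mean k (gain payoff k))"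
    by (simp add: game_mean_sum phase_mean_def)
  also have "\<dots> = (\<Sum>k<r+s. rotated_mean k (\<lambda>y. 2 * pattern_prob r s p k (nbr_index (y (- 1)) (y 1)) - 1))"
  proof (intro sum.cong refl)
    fix k
    have "phase_mean k (gain payoff k) = phase_mean k (\<lambda>(x, i). 2 * pattern_prob r s p k (circ_index N x i) - 1)"
      by (rule phase_mean_cong) (use gain in auto)
    also have "\<dots> = phase_mean k (\<lambda>z. rotation_mean N
        (\<lambda>y. 2 * pattern_prob r s p k (nbr_index (y (- 1)) (y 1)) - 1) (fst z))"
    proof (subst phase_mean_player, rule phase_mean_cong)
      have idx: "circ_index N x j = nbr_index (unroll N j x (- 1)) (unroll N j x 1)" if "j \<in> {1..N}" for x j
        using circ_index_site[OF N, of x j 0] site_0[OF that] by simp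
      fix z assume "z \<in> \<Sigma>"
      then show "(\<lambda>(x, i). (\<Sum>j=1..N. (\<lambda>(x, i). 2 * pattern_prob r s p k (circ_index N x i) - 1) (x, j)) / N) z =
          rotation_mean N (\<lambda>y. 2 * pattern_prob r s p k (nbr_index (y (- 1)) (y 1)) - 1) (fst z)"
        by (cases z) (auto simp: rotation_mean_def idx intro!: arg_cong2[where f = "(/)"] sum.cong)
    qed
    finally show "phase_mean k (gain payoff k) =
        rotated_mean k (\<lambda>y. 2 * pattern_prob r s p k (nbr_index (y (- 1)) (y 1)) - 1)"
      by (simp add: rotated_mean_def)
  qed
  finally show ?thesis .
qed

end


section \<open>The limit of many players\<close>

lemma sum_pattern_prob:
  fixes F :: "(nat \<Rightarrow> real) \<Rightarrow> real"
  shows "(\<Sum>k<r+s. F (pattern_prob r s p k)) = r * F (\<lambda>_. 1/2) + s * F p"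
proof -
  have "(\<Sum>k<r+s. F (pattern_prob r s p k)) = (\<Sum>k<r+s. if k < r then F (\<lambda>_. 1/2) else F p)"
    by (intro sum.cong) (auto simp: pattern_prob_def)
  also have "\<dots> = r * F (\<lambda>_. 1/2) + s * F p"
    by (induction s) (simp_all add: algebra_simps)
  finally show ?thesis .
qed

lemma flip_rate_mix:
  "flip_rate (mix \<gamma> p) i x = \<gamma> * flip_rate (\<lambda>_. 1/2) i x + (1 - \<gamma>) * flip_rate p i x"
  by (auto simp: flip_rate_def mix_def Let_def algebra_simps)

text \<open>Flip rates are affine in the parameters, so the generators of one period add up to a
  multiple of the generator with averaged parameters.\<close>

lemma sum_spin_gen_pattern_prob:
  assumes f: "finitely_determined f" and rs: "1 \<le> r" and \<gamma>: "\<gamma> = real r / (real r + real s)"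
  shows "(\<Sum>k<r+s. spin_gen (pattern_prob r s p k) f x) = (r + s) * spin_gen (mix \<gamma> p) f x"
proof -
  obtain A where A: "finite A" "\<And>x y. (\<forall>i\<in>A. x i = y i) \<Longrightarrow> f x = f y"
    using f unfolding finitely_determined_def by metis
  have gen: "spin_gen q f x = (\<Sum>i\<in>A. flip_rate q i x * (f (flip i x) - f x))" for q
    by (rule spin_gen_finite_sum[OF A])
  have \<gamma>': "(r + s) * \<gamma> = r" "(r + s) * (1 - \<gamma>) = s"
    using rs by (simp_all add: \<gamma> field_simps)
  have "(\<Sum>k<r+s. spin_gen (pattern_prob r s p k) f x) =
      r * spin_gen (\<lambda>_. 1/2) f x + s * spin_gen p f x"
    by (rule sum_pattern_prob)
  also have "\<dots> = (\<Sum>i\<in>A. (r * flip_rate (\<lambda>_. 1/2) i x + s * flip_rate p i x) * (f (flip i x) - f x))"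
    by (simp add: gen sum_distrib_left distrib_right sum.distrib mult.assoc)
  also have "\<dots> = (\<Sum>i\<in>A. (r + s) * (flip_rate (mix \<gamma> p) i x * (f (flip i x) - f x)))"
  proof (intro sum.cong refl)
    fix i
    have "(r + s) * flip_rate (mix \<gamma> p) i x =
        ((r + s) * \<gamma>) * flip_rate (\<lambda>_. 1/2) i x + ((r + s) * (1 - \<gamma>)) * flip_rate p i x"
      unfolding flip_rate_mix by (simp only: distrib_left mult.assoc)
    also have "\<dots> = r * flip_rate (\<lambda>_. 1/2) i x + s * flip_rate p i x"
      by (simp only: \<gamma>')
    finally show "(r * flip_rate (\<lambda>_. 1/2) i x + s * flip_rate p i x) * (f (flip i x) - f x) =
        (r + s) * (flip_rate (mix \<gamma> p) i x * (f (flip i x) - f x))"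
      by (simp only: mult.assoc[symmetric])
  qed
  also have "\<dots> = (r + s) * spin_gen (mix \<gamma> p) f x"
    by (simp add: gen sum_distrib_left)
  finally show ?thesis by simp
qed

lemma integral_marginal2:
  assumes "\<pi> \<in> space (prob_algebra borel)"
  shows "(\<integral>x. h (x i) (x j) \<partial>\<pi>) = (\<Sum>a\<in>UNIV. \<Sum>b\<in>UNIV. measure (marginal2 \<pi> i j) {(a, b)} * h a b)"
proof -
  interpret prob_space \<pi>
    using assms by (simp add: space_prob_algebra)
  define T where "T x = (x i, x j)" for x :: "int \<Rightarrow> bool"
  have sets_\<pi>: "sets \<pi> = sets borel"
    using assms by (simp add: space_prob_algebra)
  then have space_\<pi>: "space \<pi> = UNIV"
    by (simp add: sets_eq_imp_space_eq[of _ borel])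
  have T_cyl: "T -` {v} \<in> cylinders" for v
    unfolding T_def
    by (intro level_set_cylinder finitely_determined_comp2[where h = Pair] finitely_determined_coordinate)
  then have T_sets: "T -` {v} \<in> sets \<pi>" for v
    unfolding sets_\<pi> by (intro borel_open open_cylinder)
  then have T_meas: "T \<in> \<pi> \<rightarrow>\<^sub>M count_space UNIV"
    by (subst measurable_count_space_eq2) (auto simp: space_\<pi>)
  have "h (x i) (x j) = (\<Sum>v\<in>UNIV. indicator (T -` {v}) x * case_prod h v)" for x
  proof -
    have "(\<Sum>v\<in>UNIV. indicator (T -` {v}) x * case_prod h v) = (\<Sum>v\<in>UNIV. if v = T x then case_prod h v else 0)"
      by (intro sum.cong) (auto simp: indicator_def)
    then show ?thesis by (simp add: T_def)
  qed
  then have "(\<integral>x. h (x i) (x j) \<partial>\<pi>) = (\<integral>x. (\<Sum>v\<in>UNIV. indicator (T -` {v}) x * case_prod h v) \<partial>\<pi>)"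
    by simp
  also have "\<dots> = (\<Sum>v\<in>UNIV. \<integral>x. indicator (T -` {v}) x * case_prod h v \<partial>\<pi>)"
    using T_sets by (intro Bochner_Integration.integral_sum integrable_mult_left integrable_real_indicator)
      (auto simp: emeasure_eq_measure)
  also have "\<dots> = (\<Sum>v\<in>UNIV. measure (marginal2 \<pi> i j) {v} * case_prod h v)"
    using T_sets measure_distr[OF T_meas]
    by (intro sum.cong) (auto simp: marginal2_def T_def[abs_def] space_\<pi>)
  also have "\<dots> = (\<Sum>(a, b)\<in>UNIV \<times> UNIV. measure (marginal2 \<pi> i j) {(a, b)} * h a b)"
    by (intro sum.cong) auto
  finally show ?thesis
    by (simp add: sum.cartesian_product)
qed

theorem theorem9:
  fixes p :: "nat \<Rightarrow> real" and r s :: nat and \<gamma> :: real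
    and K :: "real \<Rightarrow> (int \<Rightarrow> bool) \<Rightarrow> (int \<Rightarrow> bool) measure"
    and \<pi> :: "(int \<Rightarrow> bool) measure"
  assumes p: "\<And>m. m \<le> 3 \<Longrightarrow> p m \<in> {0..1}"
    and "r \<ge> 1" and "s \<ge> 1"
    and \<gamma>: "\<gamma> = real r / (real r + real s)"
    and "spin_system (mix \<gamma> p) K"
    and "ergodic_with K \<pi>"
  shows "(\<lambda>N. mean_profit N r s p) \<longlonglongrightarrow>
    (1 - \<gamma>) * (\<Sum>w\<in>UNIV. \<Sum>z\<in>UNIV. measure (marginal2 \<pi> (-1) 1) {(w, z)} *
      (p (nbr_index w z) - (1 - p (nbr_index w z))))"
proof -
  define R where "R N k = pattern_game.rotated_mean N r s p k" for N k
  let ?L = "\<lambda>k. spin_gen (pattern_prob r s p k)"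
  have game: "pattern_game N r s p" if "1 \<le> N" for N
    using that assms by unfold_locales auto
  have mean: "\<forall>\<^sub>F N in sequentially. mean_functional (R N k)" for k
    using eventually_ge_at_top[of 1]
    by eventually_elim (simp add: R_def pattern_game.mean_functional_rotated_mean[OF game])
  \<comment> \<open>Only eventually: the window of sites read by \<open>f\<close> has to fit
    injectively on the circle.\<close>
  have R_Suc: "\<forall>\<^sub>F N in sequentially. R N (Suc k) f = R N k f + R N k (?L k f) / N"
    if f: "finitely_determined f" for k f
  proof -
    obtain A where A: "finite A" "\<And>x y. (\<forall>i\<in>A. x i = y i) \<Longrightarrow> f x = f y"
      using f unfolding finitely_determined_def by metis
    show ?thesis
      using eventually_ge_at_top[of 1] inj_on_site[OF A(1)]
    proof eventually_elim
      case (elim N)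
      show ?case
        unfolding R_def
        by (rule pattern_game.rotated_mean_Suc[OF game[OF elim(1)] A]) (use elim(2) in blast)+
    qed
  qed
  have over_N: "(\<lambda>N. R N k f / N) \<longlonglongrightarrow> 0" if f: "finitely_determined f" for k f
  proof -
    obtain C where C: "\<And>x. \<bar>f x\<bar> \<le> C"
      using finitely_determined_bounded[OF f] by blast
    show ?thesis
    proof (rule Lim_null_comparison)
      show "\<forall>\<^sub>F N in sequentially. norm (R N k f / N) \<le> C / N"
        using eventually_ge_at_top[of 1]
        by eventually_elim
          (simp add: R_def divide_right_mono pattern_game.abs_rotated_mean_le[OF game C])
      show "(\<lambda>N. C / real N) \<longlonglongrightarrow> 0"
        by (rule lim_const_over_n)
    qed
  qed
  \<comment> \<open>Each turn changes the mean by O(1/N), and k does not grow with N.\<close>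
  have drift: "(\<lambda>N. R N k f - R N 0 f) \<longlonglongrightarrow> 0" if f: "finitely_determined f" for k f
  proof (induction k)
    case (Suc k)
    have "(\<lambda>N. (R N k f - R N 0 f) + R N k (?L k f) / N) \<longlonglongrightarrow> 0 + 0"
      by (intro tendsto_add Suc over_N finitely_determined_spin_gen f)
    then have "(\<lambda>N. (R N k f - R N 0 f) + R N k (?L k f) / N) \<longlonglongrightarrow> 0"
      by simp
    then show ?case
      by (rule Lim_transform_eventually) (use R_Suc[OF f, of k] in \<open>eventually_elim, simp\<close>)
  qed simp
  have gen: "(\<lambda>N. R N 0 (spin_gen (mix \<gamma> p) f)) \<longlonglongrightarrow> 0" if f: "finitely_determined f" for f
  proof -
    have "\<forall>\<^sub>F N in sequentially. \<forall>k\<in>{..<r+s}. R N (Suc k) f = R N k f + R N k (?L k f) / N"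
      using R_Suc[OF f] by (intro eventually_ball_finite) auto
    \<comment> \<open>Telescoping over the period makes the sum of \<open>R N k (?L k f)\<close>
      exactly 0, so the left-hand side, the error of replacing phase k by phase 0, equals the mean
      of the mixed generator.\<close>
    then have ev: "\<forall>\<^sub>F N in sequentially. - (\<Sum>k<r+s. R N k (?L k f) - R N 0 (?L k f)) / (r + s) =
        R N 0 (spin_gen (mix \<gamma> p) f)"
      using eventually_ge_at_top[of 1] mean[of 0]
    proof eventually_elim
      case (elim N)
      have "(\<Sum>k<r+s. R N k (?L k f)) = N * (\<Sum>k<r+s. R N (Suc k) f - R N k f)"
        unfolding sum_distrib_left using elim(1,2) by (intro sum.cong) auto
      also have "(\<Sum>k<r+s. R N (Suc k) f - R N k f) = R N (r + s) f - R N 0 f"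
        by (rule sum_lessThan_telescope)
      also have "\<dots> = 0"
        using pattern_game.rotated_mean_period[OF game[OF elim(2)], of f] by (simp add: R_def)
      finally have zero: "(\<Sum>k<r+s. R N k (?L k f)) = 0" by simp
      have "(\<Sum>k<r+s. R N 0 (?L k f)) = R N 0 (\<lambda>x. \<Sum>k<r+s. ?L k f x)"
        by (rule mean_functional_sum[OF elim(3), symmetric])
      also have "\<dots> = (r + s) * R N 0 (spin_gen (mix \<gamma> p) f)"
        using elim(3) by (simp add: sum_spin_gen_pattern_prob[OF f \<open>r \<ge> 1\<close> \<gamma>] mean_functional_def
            del: of_nat_add)
      finally show ?case
        using zero \<open>r \<ge> 1\<close> by (simp add: sum_subtractf field_simps)
    qed
    have "(\<lambda>N. - (\<Sum>k<r+s. R N k (?L k f) - R N 0 (?L k f)) / (r + s)) \<longlonglongrightarrow> - (\<Sum>k<r+s. 0) / (r + s)"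
      by (intro tendsto_divide tendsto_minus tendsto_sum drift finitely_determined_spin_gen f tendsto_const)
        (use \<open>r \<ge> 1\<close> in simp)
    then show ?thesis
      using Lim_transform_eventually[OF _ ev] by simp
  qed
  have R_0: "(\<lambda>N. R N 0 f) \<longlonglongrightarrow> (\<integral>x. f x \<partial>\<pi>)" if "finitely_determined f" for f
    using mean_functionals_converge_to_stationary[OF assms(5,6) mean gen that] .
  have R_k: "(\<lambda>N. R N k f) \<longlonglongrightarrow> (\<integral>x. f x \<partial>\<pi>)" if "finitely_determined f" for k f
    using tendsto_add[OF drift[OF that] R_0[OF that]] by simp
  \<comment> \<open>The expected payoff of a turn with parameters \<open>q\<close> for a player at
    the origin.\<close>
  define \<psi> where "\<psi> q y = 2 * q (nbr_index (y (- 1)) (y 1)) - 1" for q :: "nat \<Rightarrow> real" and y :: "int \<Rightarrow> bool"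
  have \<psi>_fd: "finitely_determined (\<psi> q)" for q
    unfolding \<psi>_def
    by (intro finitely_determined_comp2[where h = "\<lambda>a b. 2 * q (nbr_index a b) - 1"]
        finitely_determined_coordinate)
  have "(\<lambda>N. (\<Sum>k<r+s. R N k (\<psi> (pattern_prob r s p k))) / (r + s)) \<longlonglongrightarrow>
      (\<Sum>k<r+s. \<integral>y. \<psi> (pattern_prob r s p k) y \<partial>\<pi>) / (r + s)"
    by (intro tendsto_divide tendsto_sum tendsto_const R_k \<psi>_fd) (use \<open>r \<ge> 1\<close> in simp)
  moreover have "\<forall>\<^sub>F N in sequentially. (\<Sum>k<r+s. R N k (\<psi> (pattern_prob r s p k))) / (r + s) = mean_profit N r s p"
    using eventually_ge_at_top[of 1]
  proof eventually_elim
    case (elim N)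
    then show ?case
      using pattern_game.mean_profit_rotated_mean[OF game[OF elim]] \<open>r \<ge> 1\<close>
      by (simp add: R_def \<psi>_def[abs_def] field_simps)
  qed
  ultimately have lim: "(\<lambda>N. mean_profit N r s p) \<longlonglongrightarrow>
      (\<Sum>k<r+s. \<integral>y. \<psi> (pattern_prob r s p k) y \<partial>\<pi>) / (r + s)"
    by (rule Lim_transform_eventually)
  have "(\<Sum>k<r+s. \<integral>y. \<psi> (pattern_prob r s p k) y \<partial>\<pi>) = r * (\<integral>y. \<psi> (\<lambda>_. 1/2) y \<partial>\<pi>) + s * (\<integral>y. \<psi> p y \<partial>\<pi>)"
    by (rule sum_pattern_prob)
  \<comment> \<open>Game A is fair, so only the s turns of B contribute; their share of the period
    is the factor 1 - \<gamma>.\<close>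
  also have "(\<integral>y. \<psi> (\<lambda>_. 1/2) y \<partial>\<pi>) = 0"
    by (simp add: \<psi>_def)
  finally have limit_eq: "(\<Sum>k<r+s. \<integral>y. \<psi> (pattern_prob r s p k) y \<partial>\<pi>) / (r + s) =
      (1 - \<gamma>) * (\<integral>y. \<psi> p y \<partial>\<pi>)"
    using \<open>r \<ge> 1\<close> by (simp add: \<gamma> field_simps)
  have \<pi>: "\<pi> \<in> space (prob_algebra borel)"
    using assms(6) by (simp add: ergodic_with_def stationary_distribution_def)
  have "\<psi> p = (\<lambda>y. p (nbr_index (y (- 1)) (y 1)) - (1 - p (nbr_index (y (- 1)) (y 1))))"
    by (auto simp: \<psi>_def)
  then have "(\<integral>y. \<psi> p y \<partial>\<pi>) = (\<Sum>w\<in>UNIV. \<Sum>z\<in>UNIV. measure (marginal2 \<pi> (-1) 1) {(w, z)} *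
      (p (nbr_index w z) - (1 - p (nbr_index w z))))"
    using integral_marginal2[OF \<pi>, of "\<lambda>a b. p (nbr_index a b) - (1 - p (nbr_index a b))" "- 1" 1]
    by (simp only:)
  with lim show ?thesis
    unfolding limit_eq by (simp only:)
qed

end
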